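(* Let $n\ge 2$, let $\mathcal X=\mathcal{UD}(\mathcal V,T',\theta)$ be the ultra-discretization of the positive $A_n^{(1)}$-geometric crystal $\mathcal V=\mathcal V(A_n^{(1)})$ (so $\mathcal X=\mathbb Z^{2n-2}$ as a set, with elements $x=(x_2,x_3,\dots,x_{2n-1})$), and let $B^{2,\infty}$ be the $A_n^{(1)}$-crystal described in the context. Then the map $$\Omega:\mathcal X\longrightarrow B^{2,\infty},\qquad (x_2,\dots,x_{2n-1})\mapsto b=(b_{ji})_{1\le j\le 2,\ j\le i\le j+n-1},$$ defined by $$b_{11}=x_{n+1},\quad b_{1i}=x_{n+i}-x_{n+i-1}\ (2\le i\le n-1),\quad b_{1n}=-x_{2n-1},$$ $$b_{22}=x_2,\quad b_{2i}=x_i-x_{i-1}\ (3\le i\le n),\quad b_{2,n+1}=-x_n,$$ is an isomorphism of crystals; that is, $\Omega$ is a bijection which commutes with $\tilde e_i$ and $\tilde f_i$ and preserves the functions $\mathrm{wt}_i$, $\varepsilon_i$ (hence also $\varphi_i=\varepsilon_i+\mathrm{wt}_i$) for all $i\in I=\{0,1,\dots,n\}$.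
   Context: $I=\{0,1,\dots,n\}$, $n\ge2$; the Cartan matrix of $A_n^{(1)}$ is $a_{ii}=2$, $a_{ij}=-1$ if $i\equiv j\pm1 \pmod{n+1}$, $a_{ij}=0$ otherwise. **The geometric crystal $\mathcal V$.** In the coordinates $x=(x_2,\dots,x_{2n-1})\in T'=(\mathbb C^\times)^{2n-2}$ (via the positive structure $\theta:T'\to\mathcal V$, $x\mapsto V_1(x)$), $\mathcal V$ is given by the following rational data, with the convention $x_1=x_{2n}=1$. - $e_1^c$ replaces $x_{n+1}$ by $cx_{n+1}$; $e_n^c$ replaces $x_n$ by $cx_n$; for $2\le i\le n-1$, $e_i^c$ replaces $x_i$ by $c_ix_i$ and $x_{n+i}$ by $\frac{c}{c_i}x_{n+i}$, where $c_i=\frac{c(x_ix_{n+i}+x_{i+1}x_{n+i-1})}{cx_ix_{n+i}+x_{i+1}x_{n+i-1}}$ (all other coordinates unchanged). - $\gamma_1=\frac{x_{n+1}^2}{x_2x_{n+2}}$; $\gamma_i=\frac{x_i^2x_{n+i}^2}{x_{i-1}x_{i+1}x_{n+i-1}x_{n+i+1}}$ for $2\le i\le n-1$; $\gamma_n=\frac{x_n^2}{x_{n-1}x_{2n-1}}$; $\gamma_0=\frac1{x_nx_{n+1}}$. - $\varepsilon_1=\frac{x_{n+2}}{x_{n+1}}$; $\varepsilon_i=\frac{x_{n+i+1}}{x_{n+i}}+\frac{x_{i+1}x_{n+i-1}x_{n+i+1}}{x_ix_{n+i}^2}$ for $2\le i\le n-1$; $\varepsilon_n=\frac{x_{2n-1}}{x_n}$;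 $\varepsilon_0=x_{n+1}\sum_{j=2}^n\frac{x_j}{x_{n+j-1}}$. - $e_0^c(x)=x'$, where, with $X_k=\sum_{j=2}^k\frac{x_j}{x_{n+j-1}}$, $\widetilde X_k=\sum_{j=k+1}^n\frac{x_j}{x_{n+j-1}}$, $X=X_k+\widetilde X_k$: $x_k'=x_k\frac{X}{cX_k+\widetilde X_k}$ $(2\le k<n)$, $x_n'=\frac{x_n}c$, $x_{n+1}'=\frac{x_{n+1}}c$, $x_{n+l}'=x_{n+l}\frac{cX_l+\widetilde X_l}{cX}$ $(2\le l<n)$. **Ultra-discretization.** A rational function on an algebraic torus is positive if it is a quotient $g/h$ of positive linear combinations of characters; a rational morphism $f:T\to T'$ of tori is positive if $\eta\circ f$ is positive for all characters $\eta$ of $T'$. For such $f$ define $\widehat f:X_*(T)\to X_*(T')$ on cocharacter lattices by $\langle\eta,\widehat f(\xi)\rangle=v(\eta\circ f\circ\xi)$, where $v$ of a nonzero rational function in one variable is (degree of numerator) $-$ (degree of denominator). Put $\mathcal{UD}(f)=\widehat f$; in formulas, $\times,\div,+$ become $+,-,\max$. The crystal $\mathcal X=\mathcal{UD}(\mathcal V,T',\theta)$ is $X_*(T')=\mathbb Z^{2n-2}$ with $\mathrm{wt}_i=\mathcal{UD}(\gamma_i)$, $\varepsilon_i=\mathcal{UD}(\varepsilon_i)$, $\varphi_i=\varepsilon_i+\mathrm{wt}_i$, $\tilde e_i(x)=\mathcal{UD}(e_i^c)(x)|_{c=1}$ and $\tilde f_i(x)=\mathcal{UD}(e_i^c)(x)|_{c=-1}$.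 Explicitly, with $x_1=x_{2n}=0$ and $\beta_k=x_k-x_{n+k-1}$ $(2\le k\le n)$, for example $\varepsilon_0(x)=x_{n+1}+\max_{2\le k\le n}\beta_k$, and $\mathcal{UD}(e_0^c)(x)=(x_2+C_2,\dots,x_{n-1}+C_{n-1},x_n-c,x_{n+1}-c,x_{n+2}-c-C_2,\dots,x_{2n-1}-c-C_{n-1})$ where $C_k=\max_{2\le j\le n}\beta_j-\max(\max_{2\le j\le k}(c+\beta_j),\max_{k<j\le n}\beta_j)$. **The crystal $B^{2,\infty}$.** As a set, $$B^{2,\infty}=\Big\{b=(b_{ji})_{1\le j\le2,\ j\le i\le j+n-1}\ \Big|\ b_{ji}\in\mathbb Z,\ \sum_{i=j}^{j+n-1}b_{ji}=0\ (j=1,2)\Big\}.$$ Put $z_i=b_{1i}-b_{2,i+1}$ for $2\le i\le n-1$. For $2\le m\le n$ consider the conditions - $(F_m)$: $z_k+\cdots+z_{m-1}\le0$ for $2\le k\le m-1$, and $z_m+\cdots+z_k>0$ for $m\le k\le n-1$; - $(E_m)$: $z_k+\cdots+z_{m-1}<0$ for $2\le k\le m-1$, and $z_m+\cdots+z_k\ge0$ for $m\le k\le n-1$. Let $\Delta(m)=(b_{12}+\cdots+b_{1,m-1})+(b_{2,m+1}+\cdots+b_{2n})$ and $\Delta=\min_{2\le m\le n}\Delta(m)$. Write $(x)_+=\max(x,0)$. The operators change only the listed entries: - $\tilde e_0$: if $(E_m)$ holds, $b_{11}\mapsto b_{11}-1$, $b_{1m}\mapsto b_{1m}+1$, $b_{2m}\mapsto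 b_{2m}-1$, $b_{2,n+1}\mapsto b_{2,n+1}+1$. - $\tilde f_0$: if $(F_m)$ holds, $b_{11}\mapsto b_{11}+1$, $b_{1m}\mapsto b_{1m}-1$, $b_{2m}\mapsto b_{2m}+1$, $b_{2,n+1}\mapsto b_{2,n+1}-1$. - $\tilde e_1$: $b_{11}\mapsto b_{11}+1$, $b_{12}\mapsto b_{12}-1$; $\tilde f_1$: $b_{11}\mapsto b_{11}-1$, $b_{12}\mapsto b_{12}+1$. - $\tilde e_k$, $2\le k\le n-1$: if $b_{1k}\ge b_{2,k+1}$, $b_{1k}\mapsto b_{1k}+1$, $b_{1,k+1}\mapsto b_{1,k+1}-1$; if $b_{1k}<b_{2,k+1}$, $b_{2k}\mapsto b_{2k}+1$, $b_{2,k+1}\mapsto b_{2,k+1}-1$. - $\tilde f_k$, $2\le k\le n-1$: if $b_{1k}>b_{2,k+1}$, $b_{1k}\mapsto b_{1k}-1$, $b_{1,k+1}\mapsto b_{1,k+1}+1$; if $b_{1k}\le b_{2,k+1}$, $b_{2k}\mapsto b_{2k}-1$, $b_{2,k+1}\mapsto b_{2,k+1}+1$. - $\tilde e_n$: $b_{2n}\mapsto b_{2n}+1$, $b_{2,n+1}\mapsto b_{2,n+1}-1$; $\tilde f_n$: $b_{2n}\mapsto b_{2n}-1$, $b_{2,n+1}\mapsto b_{2,n+1}+1$. (For each $b$ exactly one $(E_m)$ and exactly one $(F_m)$ holds.) Moreover - $\varepsilon_0(b)=-b_{2,n+1}-\Delta$, $\varphi_0(b)=-b_{11}-\Delta$;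 - $\varepsilon_1(b)=b_{12}$, $\varphi_1(b)=b_{11}-b_{22}$; - $\varepsilon_k(b)=b_{1,k+1}+(b_{2,k+1}-b_{1k})_+$, $\varphi_k(b)=b_{2k}+(b_{1k}-b_{2,k+1})_+$ for $2\le k\le n-1$; - $\varepsilon_n(b)=b_{2,n+1}-b_{1n}$, $\varphi_n(b)=b_{2n}$; - $\mathrm{wt}_i(b)=\varphi_i(b)-\varepsilon_i(b)$. *)

theory Defs
  imports Complex_Main "HOL-Computational_Algebra.Polynomial"
begin

text \<open>
  The torus with coordinates indexed by the finite set \<open>J\<close>.  Points are extended by \<open>1\<close> and
  (co)characters by \<open>0\<close> outside \<open>J\<close>; for \<open>J = {2..2*n-1}\<close> this builds in the conventions
  \<open>x\<^sub>1 = x\<^sub>2\<^sub>n = 1\<close> (on the torus) and \<open>x\<^sub>1 = x\<^sub>2\<^sub>n = 0\<close> (on cocharacters).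
\<close>

definition torus :: "'i set \<Rightarrow> ('i \<Rightarrow> complex) set" where
  "torus J = {x. (\<forall>j\<in>J. x j \<noteq> 0) \<and> (\<forall>j. j \<notin> J \<longrightarrow> x j = 1)}"

text \<open>Both the character lattice and the cocharacter lattice of \<open>torus J\<close> are \<open>lattice_on J\<close>.\<close>

definition lattice_on :: "'i set \<Rightarrow> ('i \<Rightarrow> int) set" where
  "lattice_on J = {\<xi>. \<forall>j. j \<notin> J \<longrightarrow> \<xi> j = 0}"

definition character :: "'i set \<Rightarrow> ('i \<Rightarrow> int) \<Rightarrow> ('i \<Rightarrow> complex) \<Rightarrow> complex" where
  "character J \<eta> x = (\<Prod>j\<in>J. x j powi \<eta> j)"

definition cocharacter :: "('i \<Rightarrow> int) \<Rightarrow> complex \<Rightarrow> ('i \<Rightarrow> complex)" where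
  "cocharacter \<xi> t = (\<lambda>j. t powi \<xi> j)"

definition pairing :: "'i set \<Rightarrow> ('i \<Rightarrow> int) \<Rightarrow> ('i \<Rightarrow> int) \<Rightarrow> int" where
  "pairing J \<eta> \<xi> = (\<Sum>j\<in>J. \<eta> j * \<xi> j)"

definition positive_combination :: "'i set \<Rightarrow> (('i \<Rightarrow> complex) \<Rightarrow> complex) \<Rightarrow> bool" where
  "positive_combination J g \<longleftrightarrow>
     (\<exists>S a. finite S \<and> S \<noteq> {} \<and> S \<subseteq> lattice_on J \<and> (\<forall>\<eta>\<in>S. (a \<eta> :: real) > 0) \<and>
            g = (\<lambda>x. \<Sum>\<eta>\<in>S. complex_of_real (a \<eta>) * character J \<eta> x))"

text \<open>
  A rational function is represented by a total function; its values on a proper closed subset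
  (where some denominator vanishes) carry no meaning.  Since numerator and denominator may be
  multiplied by a common positive factor, it suffices to require \<open>f = g / h\<close> where \<open>h\<close> does not
  vanish.
\<close>

definition positive_function :: "'i set \<Rightarrow> (('i \<Rightarrow> complex) \<Rightarrow> complex) \<Rightarrow> bool" where
  "positive_function J f \<longleftrightarrow>
     (\<exists>g h. positive_combination J g \<and> positive_combination J h \<and>
            (\<forall>x\<in>torus J. h x \<noteq> 0 \<longrightarrow> f x = g x / h x))"

definition positive_morphism ::
    "'i set \<Rightarrow> 'k set \<Rightarrow> (('i \<Rightarrow> complex) \<Rightarrow> ('k \<Rightarrow> complex)) \<Rightarrow> bool" where
  "positive_morphism J J' f \<longleftrightarrow> (\<forall>\<eta>\<in>lattice_on J'. positive_function J (character J' \<eta> \<circ> f))"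

text \<open>
  \<open>v\<close>: the degree of the numerator minus the degree of the denominator of a nonzero rational
  function in one variable, the function being given by its values up to finitely many points.
\<close>

definition rat_degree :: "(complex \<Rightarrow> complex) \<Rightarrow> int" where
  "rat_degree f =
     (THE d. \<exists>p q :: complex poly. p \<noteq> 0 \<and> q \<noteq> 0 \<and> finite {t. f t \<noteq> poly p t / poly q t} \<and>
             d = int (degree p) - int (degree q))"

definition UD ::
    "'i set \<Rightarrow> 'k set \<Rightarrow> (('i \<Rightarrow> complex) \<Rightarrow> ('k \<Rightarrow> complex)) \<Rightarrow> ('i \<Rightarrow> int) \<Rightarrow> ('k \<Rightarrow> int)" where
  "UD J J' f \<xi> =
     (if positive_morphism J J' f
      then (THE \<zeta>. \<zeta> \<in> lattice_on J' \<and>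
              (\<forall>\<eta>\<in>lattice_on J'. pairing J' \<eta> \<zeta> = rat_degree (character J' \<eta> \<circ> f \<circ> cocharacter \<xi>)))
      else undefined)"

text \<open>
  A rational function is a rational morphism to the one-dimensional torus, whose cocharacter
  lattice is identified with the integers.
\<close>

definition UD_fun :: "'i set \<Rightarrow> (('i \<Rightarrow> complex) \<Rightarrow> complex) \<Rightarrow> ('i \<Rightarrow> int) \<Rightarrow> int" where
  "UD_fun J f \<xi> = UD J {()} (\<lambda>x _. f x) \<xi> ()"

text \<open>
  All operators of the crystals below are everywhere defined, so no formal zero element is needed.
\<close>

record 'b crystal =
  elts :: "'b set"
  wt :: "nat \<Rightarrow> 'b \<Rightarrow> int"
  eps :: "nat \<Rightarrow> 'b \<Rightarrow> int"
  phi :: "nat \<Rightarrow> 'b \<Rightarrow> int"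
  etil :: "nat \<Rightarrow> 'b \<Rightarrow> 'b"
  ftil :: "nat \<Rightarrow> 'b \<Rightarrow> 'b"

definition crystal_iso :: "nat set \<Rightarrow> 'a crystal \<Rightarrow> 'b crystal \<Rightarrow> ('a \<Rightarrow> 'b) \<Rightarrow> bool" where
  "crystal_iso I X Y \<Omega> \<longleftrightarrow>
     bij_betw \<Omega> (elts X) (elts Y) \<and>
     (\<forall>i\<in>I. \<forall>x\<in>elts X.
        \<Omega> (etil X i x) = etil Y i (\<Omega> x) \<and>
        \<Omega> (ftil X i x) = ftil Y i (\<Omega> x) \<and>
        wt Y i (\<Omega> x) = wt X i x \<and>
        eps Y i (\<Omega> x) = eps X i x \<and>
        phi Y i (\<Omega> x) = phi X i x)"

definition coords :: "nat \<Rightarrow> nat set" where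
  "coords n = {2..2 * n - 1}"

definition X_low :: "nat \<Rightarrow> (nat \<Rightarrow> complex) \<Rightarrow> nat \<Rightarrow> complex" where
  "X_low n x k = (\<Sum>j=2..k. x j / x (n + j - 1))"

definition X_high :: "nat \<Rightarrow> (nat \<Rightarrow> complex) \<Rightarrow> nat \<Rightarrow> complex" where
  "X_high n x k = (\<Sum>j=k+1..n. x j / x (n + j - 1))"

definition geom_e0 :: "nat \<Rightarrow> complex \<Rightarrow> (nat \<Rightarrow> complex) \<Rightarrow> (nat \<Rightarrow> complex)" where
  "geom_e0 n c x = (\<lambda>k.
     if 2 \<le> k \<and> k < n then
       x k * ((X_low n x k + X_high n x k) / (c * X_low n x k + X_high n x k))
     else if k = n \<or> k = n + 1 then x k / c
     else if n + 2 \<le> k \<and> k < 2 * n then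
       (let l = k - n in
        x k * ((c * X_low n x l + X_high n x l) / (c * (X_low n x l + X_high n x l))))
     else x k)"

definition geom_c :: "nat \<Rightarrow> nat \<Rightarrow> complex \<Rightarrow> (nat \<Rightarrow> complex) \<Rightarrow> complex" where
  "geom_c n i c x =
     c * (x i * x (n + i) + x (i + 1) * x (n + i - 1)) /
     (c * x i * x (n + i) + x (i + 1) * x (n + i - 1))"

definition geom_e :: "nat \<Rightarrow> nat \<Rightarrow> complex \<Rightarrow> (nat \<Rightarrow> complex) \<Rightarrow> (nat \<Rightarrow> complex)" where
  "geom_e n i c x =
     (if i = 0 then geom_e0 n c x
      else if i = 1 then x(n + 1 := c * x (n + 1))
      else if i = n then x(n := c * x n)
      else x(i := geom_c n i c x * x i, n + i := c / geom_c n i c x * x (n + i)))"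

definition geom_gamma :: "nat \<Rightarrow> nat \<Rightarrow> (nat \<Rightarrow> complex) \<Rightarrow> complex" where
  "geom_gamma n i x =
     (if i = 0 then 1 / (x n * x (n + 1))
      else if i = 1 then x (n + 1) ^ 2 / (x 2 * x (n + 2))
      else if i = n then x n ^ 2 / (x (n - 1) * x (2 * n - 1))
      else x i ^ 2 * x (n + i) ^ 2 /
           (x (i - 1) * x (i + 1) * x (n + i - 1) * x (n + i + 1)))"

definition geom_eps :: "nat \<Rightarrow> nat \<Rightarrow> (nat \<Rightarrow> complex) \<Rightarrow> complex" where
  "geom_eps n i x =
     (if i = 0 then x (n + 1) * (\<Sum>j=2..n. x j / x (n + j - 1))
      else if i = 1 then x (n + 2) / x (n + 1)
      else if i = n then x (2 * n - 1) / x n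
      else x (n + i + 1) / x (n + i) +
           x (i + 1) * x (n + i - 1) * x (n + i + 1) / (x i * x (n + i) ^ 2))"

text \<open>
  The action \<open>(c, x) \<mapsto> e\<^sub>i\<^sup>c(x)\<close> is a rational morphism from the product of the
  one-dimensional torus with \<open>torus (coords n)\<close>.  The coordinate \<open>c\<close> is put at the index \<open>0\<close>,
  which does not belong to \<open>coords n\<close>.
\<close>

definition UD_e :: "nat \<Rightarrow> nat \<Rightarrow> int \<Rightarrow> (nat \<Rightarrow> int) \<Rightarrow> (nat \<Rightarrow> int)" where
  "UD_e n i c \<xi> =
     UD (insert 0 (coords n)) (coords n) (\<lambda>y. geom_e n i (y 0) (y(0 := 1))) (\<xi>(0 := c))"

definition UD_crystal :: "nat \<Rightarrow> (nat \<Rightarrow> int) crystal" where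
  "UD_crystal n =
     \<lparr> elts = lattice_on (coords n),
       wt = (\<lambda>i. UD_fun (coords n) (geom_gamma n i)),
       eps = (\<lambda>i. UD_fun (coords n) (geom_eps n i)),
       phi = (\<lambda>i \<xi>. UD_fun (coords n) (geom_eps n i) \<xi> + UD_fun (coords n) (geom_gamma n i) \<xi>),
       etil = (\<lambda>i. UD_e n i 1),
       ftil = (\<lambda>i. UD_e n i (- 1)) \<rparr>"

text \<open>The entry \<open>b\<^sub>j\<^sub>i\<close> is \<open>b j i\<close>; entries outside the index range are \<open>0\<close>.\<close>

definition B2inf_set :: "nat \<Rightarrow> (nat \<Rightarrow> nat \<Rightarrow> int) set" where
  "B2inf_set n =
     {b. (\<forall>j i. \<not> (j \<in> {1..2} \<and> i \<in> {j..j + n - 1}) \<longrightarrow> b j i = 0) \<and>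
         (\<forall>j\<in>{1..2}. (\<Sum>i=j..j + n - 1. b j i) = 0)}"

definition zdiff :: "(nat \<Rightarrow> nat \<Rightarrow> int) \<Rightarrow> nat \<Rightarrow> int" where
  "zdiff b i = b 1 i - b 2 (i + 1)"

definition condF :: "nat \<Rightarrow> (nat \<Rightarrow> nat \<Rightarrow> int) \<Rightarrow> nat \<Rightarrow> bool" where
  "condF n b m \<longleftrightarrow>
     (\<forall>k\<in>{2..m - 1}. (\<Sum>i=k..m - 1. zdiff b i) \<le> 0) \<and>
     (\<forall>k\<in>{m..n - 1}. (\<Sum>i=m..k. zdiff b i) > 0)"

definition condE :: "nat \<Rightarrow> (nat \<Rightarrow> nat \<Rightarrow> int) \<Rightarrow> nat \<Rightarrow> bool" where
  "condE n b m \<longleftrightarrow>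
     (\<forall>k\<in>{2..m - 1}. (\<Sum>i=k..m - 1. zdiff b i) < 0) \<and>
     (\<forall>k\<in>{m..n - 1}. (\<Sum>i=m..k. zdiff b i) \<ge> 0)"

definition Delta_at :: "nat \<Rightarrow> (nat \<Rightarrow> nat \<Rightarrow> int) \<Rightarrow> nat \<Rightarrow> int" where
  "Delta_at n b m = (\<Sum>i=2..m - 1. b 1 i) + (\<Sum>i=m + 1..n. b 2 i)"

definition Delta :: "nat \<Rightarrow> (nat \<Rightarrow> nat \<Rightarrow> int) \<Rightarrow> int" where
  "Delta n b = Min (Delta_at n b ` {2..n})"

definition add_entry :: "nat \<Rightarrow> nat \<Rightarrow> int \<Rightarrow> (nat \<Rightarrow> nat \<Rightarrow> int) \<Rightarrow> (nat \<Rightarrow> nat \<Rightarrow> int)" where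
  "add_entry j i d b = b(j := (b j)(i := b j i + d))"

definition B_e :: "nat \<Rightarrow> nat \<Rightarrow> (nat \<Rightarrow> nat \<Rightarrow> int) \<Rightarrow> (nat \<Rightarrow> nat \<Rightarrow> int)" where
  "B_e n i b =
     (if i = 0 then
        (let m = (THE m. m \<in> {2..n} \<and> condE n b m) in
         (add_entry 1 1 (- 1) \<circ> add_entry 1 m 1 \<circ> add_entry 2 m (- 1) \<circ> add_entry 2 (n + 1) 1) b)
      else if i = 1 then (add_entry 1 1 1 \<circ> add_entry 1 2 (- 1)) b
      else if i = n then (add_entry 2 n 1 \<circ> add_entry 2 (n + 1) (- 1)) b
      else if b 1 i \<ge> b 2 (i + 1) then (add_entry 1 i 1 \<circ> add_entry 1 (i + 1) (- 1)) b
      else (add_entry 2 i 1 \<circ> add_entry 2 (i + 1) (- 1)) b)"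

definition B_f :: "nat \<Rightarrow> nat \<Rightarrow> (nat \<Rightarrow> nat \<Rightarrow> int) \<Rightarrow> (nat \<Rightarrow> nat \<Rightarrow> int)" where
  "B_f n i b =
     (if i = 0 then
        (let m = (THE m. m \<in> {2..n} \<and> condF n b m) in
         (add_entry 1 1 1 \<circ> add_entry 1 m (- 1) \<circ> add_entry 2 m 1 \<circ> add_entry 2 (n + 1) (- 1)) b)
      else if i = 1 then (add_entry 1 1 (- 1) \<circ> add_entry 1 2 1) b
      else if i = n then (add_entry 2 n (- 1) \<circ> add_entry 2 (n + 1) 1) b
      else if b 1 i > b 2 (i + 1) then (add_entry 1 i (- 1) \<circ> add_entry 1 (i + 1) 1) b
      else (add_entry 2 i (- 1) \<circ> add_entry 2 (i + 1) 1) b)"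

definition B_eps :: "nat \<Rightarrow> nat \<Rightarrow> (nat \<Rightarrow> nat \<Rightarrow> int) \<Rightarrow> int" where
  "B_eps n i b =
     (if i = 0 then - b 2 (n + 1) - Delta n b
      else if i = 1 then b 1 2
      else if i = n then b 2 (n + 1) - b 1 n
      else b 1 (i + 1) + max (b 2 (i + 1) - b 1 i) 0)"

definition B_phi :: "nat \<Rightarrow> nat \<Rightarrow> (nat \<Rightarrow> nat \<Rightarrow> int) \<Rightarrow> int" where
  "B_phi n i b =
     (if i = 0 then - b 1 1 - Delta n b
      else if i = 1 then b 1 1 - b 2 2
      else if i = n then b 2 n
      else b 2 i + max (b 1 i - b 2 (i + 1)) 0)"

definition B2inf :: "nat \<Rightarrow> (nat \<Rightarrow> nat \<Rightarrow> int) crystal" where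
  "B2inf n =
     \<lparr> elts = B2inf_set n,
       wt = (\<lambda>i b. B_phi n i b - B_eps n i b),
       eps = B_eps n,
       phi = B_phi n,
       etil = B_e n,
       ftil = B_f n \<rparr>"

definition Omega :: "nat \<Rightarrow> (nat \<Rightarrow> int) \<Rightarrow> (nat \<Rightarrow> nat \<Rightarrow> int)" where
  "Omega n x = (\<lambda>j i.
     if j = 1 then
       (if i = 1 then x (n + 1)
        else if 2 \<le> i \<and> i \<le> n - 1 then x (n + i) - x (n + i - 1)
        else if i = n then - x (2 * n - 1)
        else 0)
     else if j = 2 then
       (if i = 2 then x 2
        else if 3 \<le> i \<and> i \<le> n then x i - x (i - 1)
        else if i = n + 1 then - x n
        else 0)
     else 0)"

end

theory Submission
  imports Defs "HOL-Analysis.Elementary_Normed_Spaces"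
begin

text \<open>
  The degree of a positive rational function along a cocharacter \<open>\<xi>\<close> is read off from its growth:
  \<open>f (t powi \<xi>) / t powi d\<close> tends to a positive real as \<open>t\<close> tends to infinity.  Leading
  coefficients being positive, no cancellation occurs in sums, so this growth exponent turns
  products into sums and sums into maxima, and the ultra-discretizations can be computed term by
  term.

  What remains is a statement about integers, and only \<open>i = 0\<close> is not local.  There
  \<open>zdiff (Omega n x) k = \<beta>\<^sub>k - \<beta>\<^sub>k\<^sub>+\<^sub>1\<close> with \<open>\<beta>\<^sub>k = x\<^sub>k - x\<^sub>n\<^sub>+\<^sub>k\<^sub>-\<^sub>1\<close>, so \<open>condE\<close> singles out the
  first and \<open>condF\<close> the last index \<open>m\<close> at which \<open>\<beta>\<close> is maximal.  The integer \<open>C\<^sub>k\<close>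
  occurring in the action of \<open>e\<^sub>0\<^sup>c\<close> for \<open>c = 1\<close> and \<open>c = -1\<close>, respectively, is then \<open>-c\<close> for
  \<open>k \<ge> m\<close> and \<open>0\<close> for \<open>k < m\<close>.
\<close>

section \<open>Positive functions on a torus\<close>

lemma character_add:
  assumes "x \<in> torus J"
  shows "character J (\<lambda>j. \<eta> j + \<theta> j) x = character J \<eta> x * character J \<theta> x"
  using assms by (auto simp: character_def torus_def power_int_add prod.distrib[symmetric]
      intro!: prod.cong)

lemma cocharacter_in_torus: "\<xi> \<in> lattice_on J \<Longrightarrow> t \<noteq> 0 \<Longrightarrow> cocharacter \<xi> t \<in> torus J"
  by (auto simp: torus_def lattice_on_def cocharacter_def)

lemma character_cocharacter:
  assumes "t \<noteq> 0"
  shows "character J \<eta> (cocharacter \<xi> t) = t powi pairing J \<eta> \<xi>"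
proof (cases "finite J")
  case True
  have "(\<Prod>j\<in>J. (t powi \<xi> j) powi \<eta> j) = t powi (\<Sum>j\<in>J. \<eta> j * \<xi> j)"
    using True
    by (induction J rule: finite_induct)
      (use assms in \<open>simp_all add: power_int_add power_int_mult[symmetric] mult.commute\<close>)
  then show ?thesis
    by (simp add: character_def cocharacter_def pairing_def)
\<comment> \<open>For infinite \<open>J\<close> both \<open>prod\<close> and \<open>sum\<close> take
  their default values, and both sides are 1.\<close>
qed (simp add: character_def pairing_def)

text \<open>
  Characters are multiplicative only on the torus, so closure under products needs a version of
  positive combinations up to equality on the torus.
\<close>

definition pos_sum :: "'i set \<Rightarrow> (('i \<Rightarrow> complex) \<Rightarrow> complex) \<Rightarrow> bool" where
  "pos_sum J g \<longleftrightarrow> (\<exists>g'. positive_combination J g' \<and> (\<forall>x\<in>torus J. g x = g' x))"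

lemma pos_sum_cong: "(\<And>x. x \<in> torus J \<Longrightarrow> g x = h x) \<Longrightarrow> pos_sum J g \<longleftrightarrow> pos_sum J h"
  by (auto simp: pos_sum_def)

lemma pos_sum_iff:
  "pos_sum J g \<longleftrightarrow>
     (\<exists>S a. finite S \<and> S \<noteq> {} \<and> S \<subseteq> lattice_on J \<and> (\<forall>\<eta>\<in>S. (a \<eta> :: real) > 0) \<and>
            (\<forall>x\<in>torus J. g x = (\<Sum>\<eta>\<in>S. complex_of_real (a \<eta>) * character J \<eta> x)))"
  unfolding pos_sum_def positive_combination_def by blast

lemma pos_sum_monomial:
  assumes "\<eta> \<in> lattice_on J" "c > 0"
  shows "pos_sum J (\<lambda>x. complex_of_real c * character J \<eta> x)"
  unfolding pos_sum_iff
  by (rule exI[of _ "{\<eta>}"], rule exI[of _ "\<lambda>_. c"]) (use assms in auto)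

lemma pos_sum_add:
  assumes "pos_sum J g" "pos_sum J h"
  shows "pos_sum J (\<lambda>x. g x + h x)"
proof -
  obtain S a where S: "finite S" "S \<noteq> {}" "S \<subseteq> lattice_on J" "\<forall>\<eta>\<in>S. (a \<eta> :: real) > 0"
    "\<forall>x\<in>torus J. g x = (\<Sum>\<eta>\<in>S. complex_of_real (a \<eta>) * character J \<eta> x)"
    using assms(1) unfolding pos_sum_iff by blast
  obtain T b where T: "finite T" "T \<noteq> {}" "T \<subseteq> lattice_on J" "\<forall>\<eta>\<in>T. (b \<eta> :: real) > 0"
    "\<forall>x\<in>torus J. h x = (\<Sum>\<eta>\<in>T. complex_of_real (b \<eta>) * character J \<eta> x)"
    using assms(2) unfolding pos_sum_iff by blast
  \<comment> \<open>Extension by 0 merges exponents common to both sums; on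
    \<open>S \<union> T\<close> at least one of the two coefficients is positive.\<close>
  define a' where "a' = (\<lambda>\<eta>. if \<eta> \<in> S then a \<eta> else 0)"
  define b' where "b' = (\<lambda>\<eta>. if \<eta> \<in> T then b \<eta> else 0)"
  have 1: "(\<Sum>\<eta>\<in>S. complex_of_real (a \<eta>) * character J \<eta> x) =
      (\<Sum>\<eta>\<in>S \<union> T. complex_of_real (a' \<eta>) * character J \<eta> x)" for x
    by (rule sum.mono_neutral_cong_left) (use S(1) T(1) in \<open>auto simp: a'_def\<close>)
  have 2: "(\<Sum>\<eta>\<in>T. complex_of_real (b \<eta>) * character J \<eta> x) =
      (\<Sum>\<eta>\<in>S \<union> T. complex_of_real (b' \<eta>) * character J \<eta> x)" for x
    by (rule sum.mono_neutral_cong_left) (use S(1) T(1) in \<open>auto simp: b'_def\<close>)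
  show ?thesis
    unfolding pos_sum_iff
  proof (rule exI[of _ "S \<union> T"], rule exI[of _ "\<lambda>\<eta>. a' \<eta> + b' \<eta>"], intro conjI ballI)
    fix \<eta> assume "\<eta> \<in> S \<union> T"
    then show "a' \<eta> + b' \<eta> > 0"
      using S(4) T(4) by (auto simp: a'_def b'_def add_pos_pos)
  next
    fix x assume "x \<in> torus J"
    then show "g x + h x = (\<Sum>\<eta>\<in>S \<union> T. complex_of_real (a' \<eta> + b' \<eta>) * character J \<eta> x)"
      using S(5) T(5) by (simp add: 1 2 sum.distrib[symmetric] ring_distribs)
  qed (use S T in auto)
qed

lemma pos_sum_sum:
  assumes "finite A" "A \<noteq> {}" "\<And>i. i \<in> A \<Longrightarrow> pos_sum J (g i)"
  shows "pos_sum J (\<lambda>x. \<Sum>i\<in>A. g i x)"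
  using assms by (induction A rule: finite_ne_induct) (auto intro: pos_sum_add)

text \<open>Different pairs of exponents may have the same sum, so the expanded product is assembled
  from single monomials by \<open>pos_sum_sum\<close>, which collects the coinciding ones.\<close>

lemma pos_sum_mult:
  assumes "pos_sum J g" "pos_sum J h"
  shows "pos_sum J (\<lambda>x. g x * h x)"
proof -
  obtain S a where S: "finite S" "S \<noteq> {}" "S \<subseteq> lattice_on J" "\<forall>\<eta>\<in>S. (a \<eta> :: real) > 0"
    "\<forall>x\<in>torus J. g x = (\<Sum>\<eta>\<in>S. complex_of_real (a \<eta>) * character J \<eta> x)"
    using assms(1) unfolding pos_sum_iff by blast
  obtain T b where T: "finite T" "T \<noteq> {}" "T \<subseteq> lattice_on J" "\<forall>\<eta>\<in>T. (b \<eta> :: real) > 0"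
    "\<forall>x\<in>torus J. h x = (\<Sum>\<eta>\<in>T. complex_of_real (b \<eta>) * character J \<eta> x)"
    using assms(2) unfolding pos_sum_iff by blast
  have "pos_sum J (\<lambda>x. \<Sum>\<eta>\<in>S. \<Sum>\<theta>\<in>T.
          complex_of_real (a \<eta> * b \<theta>) * character J (\<lambda>j. \<eta> j + \<theta> j) x)"
    using S(1-4) T(1-4) by (intro pos_sum_sum pos_sum_monomial) (auto simp: lattice_on_def subset_iff)
  then show ?thesis
    by (subst pos_sum_cong[where h = "\<lambda>x. \<Sum>\<eta>\<in>S. \<Sum>\<theta>\<in>T.
          complex_of_real (a \<eta> * b \<theta>) * character J (\<lambda>j. \<eta> j + \<theta> j) x"])
      (use S(5) T(5) in \<open>auto simp: character_add sum_product mult_ac\<close>)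
qed

lemma positive_function_iff:
  "positive_function J f \<longleftrightarrow>
     (\<exists>g h. pos_sum J g \<and> pos_sum J h \<and> (\<forall>x\<in>torus J. h x \<noteq> 0 \<longrightarrow> f x = g x / h x))"
  unfolding positive_function_def pos_sum_def by (metis (no_types, lifting))

lemma positive_function_cong:
  "(\<And>x. x \<in> torus J \<Longrightarrow> f x = g x) \<Longrightarrow> positive_function J f \<longleftrightarrow> positive_function J g"
  by (auto simp: positive_function_def)

lemma pos_sum_1: "pos_sum J (\<lambda>_. 1)"
  using pos_sum_monomial[of "\<lambda>_. 0" J 1] by (simp add: lattice_on_def character_def)

lemma pos_sum_positive_function: "pos_sum J f \<Longrightarrow> positive_function J f"
  unfolding positive_function_iff using pos_sum_1[of J] by fastforce

lemma positive_function_add: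
  assumes "positive_function J f" "positive_function J f'"
  shows "positive_function J (\<lambda>x. f x + f' x)"
proof -
  obtain g h where gh: "pos_sum J g" "pos_sum J h" "\<forall>x\<in>torus J. h x \<noteq> 0 \<longrightarrow> f x = g x / h x"
    using assms(1) unfolding positive_function_iff by blast
  obtain g' h' where gh': "pos_sum J g'" "pos_sum J h'"
    "\<forall>x\<in>torus J. h' x \<noteq> 0 \<longrightarrow> f' x = g' x / h' x"
    using assms(2) unfolding positive_function_iff by blast
  show ?thesis
    unfolding positive_function_iff
    by (rule exI[of _ "\<lambda>x. g x * h' x + g' x * h x"], rule exI[of _ "\<lambda>x. h x * h' x"])
      (use gh gh' in \<open>auto intro!: pos_sum_add pos_sum_mult simp: field_simps\<close>)
qed

lemma positive_function_mult:
  assumes "positive_function J f" "positive_function J f'"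
  shows "positive_function J (\<lambda>x. f x * f' x)"
proof -
  obtain g h where gh: "pos_sum J g" "pos_sum J h" "\<forall>x\<in>torus J. h x \<noteq> 0 \<longrightarrow> f x = g x / h x"
    using assms(1) unfolding positive_function_iff by blast
  obtain g' h' where gh': "pos_sum J g'" "pos_sum J h'"
    "\<forall>x\<in>torus J. h' x \<noteq> 0 \<longrightarrow> f' x = g' x / h' x"
    using assms(2) unfolding positive_function_iff by blast
  show ?thesis
    unfolding positive_function_iff
    by (rule exI[of _ "\<lambda>x. g x * g' x"], rule exI[of _ "\<lambda>x. h x * h' x"])
      (use gh gh' in \<open>auto intro!: pos_sum_mult\<close>)
qed

text \<open>
  The quotient \<open>h / g\<close> is expanded by \<open>h\<close>, because \<open>f\<close> is arbitrary where \<open>h\<close> vanishes.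
\<close>

lemma positive_function_inverse:
  assumes "positive_function J f"
  shows "positive_function J (\<lambda>x. inverse (f x))"
proof -
  obtain g h where gh: "pos_sum J g" "pos_sum J h" "\<forall>x\<in>torus J. h x \<noteq> 0 \<longrightarrow> f x = g x / h x"
    using assms(1) unfolding positive_function_iff by blast
  show ?thesis
    unfolding positive_function_iff
    by (rule exI[of _ "\<lambda>x. h x * h x"], rule exI[of _ "\<lambda>x. g x * h x"])
      (use gh in \<open>auto intro!: pos_sum_mult\<close>)
qed

section \<open>Growth at infinity\<close>

text \<open>The existence part of the description in \<open>rat_degree\<close>; uniqueness of the
  degree comes from growth.\<close>

definition cofin_rational :: "(complex \<Rightarrow> complex) \<Rightarrow> bool" where
  "cofin_rational f \<longleftrightarrow>
     (\<exists>p q :: complex poly. p \<noteq> 0 \<and> q \<noteq> 0 \<and> finite {t. f t \<noteq> poly p t / poly q t})"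

text \<open>A limit at infinity ignores finitely many points, in particular 0 and the zeros of
  denominators, where values are arbitrary.\<close>

definition pos_growth :: "(complex \<Rightarrow> complex) \<Rightarrow> int \<Rightarrow> bool" where
  "pos_growth f d \<longleftrightarrow> (\<exists>L>0. ((\<lambda>t. f t / t powi d) \<longlongrightarrow> complex_of_real L) at_infinity)"

lemma eventually_at_infinity_cofinite:
  assumes "finite {t :: complex. \<not> P t}"
  shows "eventually P at_infinity"
proof -
  obtain B where "norm t \<le> B" if "\<not> P t" for t
    using bdd_above_finite[OF finite_imageI[OF assms, of norm]] unfolding bdd_above_def by auto
  then show ?thesis
    unfolding eventually_at_infinity by (intro exI[of _ "B + 1"]) force
qed

lemma eventually_nonzero_at_infinity: "eventually (\<lambda>t :: complex. t \<noteq> 0) at_infinity"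
  by (rule eventually_at_infinity_cofinite) simp

lemma powi_neg_tendsto_0:
  assumes "d < 0"
  shows "((\<lambda>t :: complex. t powi d) \<longlongrightarrow> 0) at_infinity"
proof -
  have "((\<lambda>t :: complex. inverse (t ^ nat (- d))) \<longlongrightarrow> 0) at_infinity"
    using assms by (intro filterlim_compose[OF tendsto_inverse_0] filterlim_power_at_infinity) auto
  moreover have "t powi d = inverse (t ^ nat (- d))" for t :: complex
    using assms by (simp add: power_int_def power_inverse)
  ultimately show ?thesis by simp
qed

lemma poly_quotient_powi_tendsto:
  fixes p q :: "complex poly"
  assumes "q \<noteq> 0"
  shows "((\<lambda>t. poly p t / poly q t / t powi (int (degree p) - int (degree q)))
           \<longlongrightarrow> lead_coeff p / lead_coeff q) at_infinity"
proof -
  have "((\<lambda>t. (poly p t / t ^ degree p) / (poly q t / t ^ degree q))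
           \<longlongrightarrow> lead_coeff p / lead_coeff q) at_infinity"
    using assms by (intro tendsto_divide poly_divide_tendsto_aux) simp
  then show ?thesis
    by (rule Lim_transform_eventually)
      (use eventually_nonzero_at_infinity in eventually_elim,
        simp add: power_int_diff field_simps)
qed

text \<open>A representing quotient, divided by \<open>t\<close> to the difference of its degrees,
  tends to a nonzero number. At most one exponent can give a finite nonzero limit, so every
  representation yields the same \<open>d\<close>.\<close>

lemma rat_degree_eq:
  assumes "cofin_rational f" "pos_growth f d"
  shows "rat_degree f = d"
proof -
  obtain L where L: "L > 0" "((\<lambda>t. f t / t powi d) \<longlongrightarrow> complex_of_real L) at_infinity"
    using assms(2) unfolding pos_growth_def by blast
  have *: "d = int (degree p) - int (degree q)"
    if pq: "p \<noteq> 0" "q \<noteq> 0" "finite {t. f t \<noteq> poly p t / poly q t}" for p q :: "complex poly"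
  proof -
    define e where "e = int (degree p) - int (degree q)"
    define M where "M = lead_coeff p / lead_coeff q"
    have M: "M \<noteq> 0" using pq by (simp add: M_def)
    have ev: "eventually (\<lambda>t. f t = poly p t / poly q t) at_infinity"
      by (rule eventually_at_infinity_cofinite[OF pq(3)])
    have lim: "((\<lambda>t. f t / t powi e) \<longlongrightarrow> M) at_infinity"
      unfolding e_def M_def
      by (rule Lim_transform_eventually[OF poly_quotient_powi_tendsto[OF pq(2)]])
        (use ev in eventually_elim, simp)
    show ?thesis unfolding e_def[symmetric]
    proof (rule ccontr)
      assume "d \<noteq> e"
      then consider "e < d" | "d < e" by linarith
      then show False
      proof cases
        case 1
        \<comment> \<open>Growth of order \<open>e < d\<close> makes the limit for the exponent
          \<open>d\<close> vanish, against \<open>L > 0\<close>; the other case contradicts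
          \<open>M \<noteq> 0\<close> in the same way.\<close>
        have "((\<lambda>t. f t / t powi e * t powi (e - d)) \<longlongrightarrow> M * 0) at_infinity"
          using 1 by (intro tendsto_mult lim powi_neg_tendsto_0) simp
        then have "((\<lambda>t. f t / t powi d) \<longlongrightarrow> M * 0) at_infinity"
          by (rule Lim_transform_eventually)
            (use eventually_nonzero_at_infinity in eventually_elim,
              simp add: power_int_diff field_simps)
        from tendsto_unique[OF trivial_limit_at_infinity this L(2)] show False using L(1) by simp
      next
        case 2
        have "((\<lambda>t. f t / t powi d * t powi (d - e)) \<longlongrightarrow> of_real L * 0) at_infinity"
          using 2 by (intro tendsto_mult L powi_neg_tendsto_0) simp
        then have "((\<lambda>t. f t / t powi e) \<longlongrightarrow> of_real L * 0) at_infinity"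
          by (rule Lim_transform_eventually)
            (use eventually_nonzero_at_infinity in eventually_elim,
              simp add: power_int_diff field_simps)
        from tendsto_unique[OF trivial_limit_at_infinity this lim] show False using M by simp
      qed
    qed
  qed
  obtain p q :: "complex poly" where pq: "p \<noteq> 0" "q \<noteq> 0" "finite {t. f t \<noteq> poly p t / poly q t}"
    using assms(1) unfolding cofin_rational_def by blast
  show ?thesis
    unfolding rat_degree_def by (rule the_equality) (use pq * in blast)+
qed

lemma pos_growth_cong:
  assumes "\<And>t. t \<noteq> 0 \<Longrightarrow> f t = g t" "pos_growth f d"
  shows "pos_growth g d"
proof -
  obtain L where L: "L > 0" "((\<lambda>t. f t / t powi d) \<longlongrightarrow> complex_of_real L) at_infinity"
    using assms(2) unfolding pos_growth_def by blast
  have "((\<lambda>t. g t / t powi d) \<longlongrightarrow> complex_of_real L) at_infinity"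
    by (rule Lim_transform_eventually[OF L(2)])
      (use eventually_nonzero_at_infinity in eventually_elim, simp add: assms(1))
  with L(1) show ?thesis unfolding pos_growth_def by blast
qed

lemma pos_growth_powi: "pos_growth (\<lambda>t. t powi d) d"
proof -
  have "((\<lambda>t :: complex. t powi d / t powi d) \<longlongrightarrow> 1) at_infinity"
    by (rule Lim_transform_eventually[OF tendsto_const])
      (use eventually_nonzero_at_infinity in eventually_elim, simp)
  then show ?thesis unfolding pos_growth_def by (intro exI[of _ 1]) auto
qed

lemma pos_growth_mult:
  assumes "pos_growth f d" "pos_growth g e"
  shows "pos_growth (\<lambda>t. f t * g t) (d + e)"
proof -
  obtain L where L: "L > 0" "((\<lambda>t. f t / t powi d) \<longlongrightarrow> complex_of_real L) at_infinity"
    using assms(1) unfolding pos_growth_def by blast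
  obtain M where M: "M > 0" "((\<lambda>t. g t / t powi e) \<longlongrightarrow> complex_of_real M) at_infinity"
    using assms(2) unfolding pos_growth_def by blast
  have "((\<lambda>t. f t * g t / t powi (d + e)) \<longlongrightarrow> complex_of_real (L * M)) at_infinity"
    unfolding of_real_mult
    by (rule Lim_transform_eventually[OF tendsto_mult[OF L(2) M(2)]])
      (use eventually_nonzero_at_infinity in eventually_elim, simp add: power_int_add)
  with L(1) M(1) show ?thesis unfolding pos_growth_def by (intro exI[of _ "L * M"]) auto
qed

lemma pos_growth_inverse:
  assumes "pos_growth f d"
  shows "pos_growth (\<lambda>t. inverse (f t)) (- d)"
proof -
  obtain L where L: "L > 0" "((\<lambda>t. f t / t powi d) \<longlongrightarrow> complex_of_real L) at_infinity"
    using assms(1) unfolding pos_growth_def by blast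
  have "((\<lambda>t. inverse (f t / t powi d)) \<longlongrightarrow> inverse (complex_of_real L)) at_infinity"
    using L by (intro tendsto_inverse) auto
  then have "((\<lambda>t. inverse (f t) / t powi (- d)) \<longlongrightarrow> complex_of_real (inverse L)) at_infinity"
    by (simp add: power_int_minus divide_inverse mult.commute)
  with L(1) show ?thesis unfolding pos_growth_def by (intro exI[of _ "inverse L"]) auto
qed

lemma pos_growth_add_less:
  assumes "pos_growth f d" "pos_growth g e" "d < e"
  shows "pos_growth (\<lambda>t. f t + g t) e"
proof -
  obtain L where L: "L > 0" "((\<lambda>t. f t / t powi d) \<longlongrightarrow> complex_of_real L) at_infinity"
    using assms(1) unfolding pos_growth_def by blast
  obtain M where M: "M > 0" "((\<lambda>t. g t / t powi e) \<longlongrightarrow> complex_of_real M) at_infinity"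
    using assms(2) unfolding pos_growth_def by blast
  have "((\<lambda>t. f t / t powi d * t powi (d - e) + g t / t powi e)
          \<longlongrightarrow> complex_of_real L * 0 + complex_of_real M) at_infinity"
    using assms(3) by (intro tendsto_add tendsto_mult L M powi_neg_tendsto_0) simp
  then have "((\<lambda>t. (f t + g t) / t powi e) \<longlongrightarrow> complex_of_real L * 0 + complex_of_real M) at_infinity"
    by (rule Lim_transform_eventually)
      (use eventually_nonzero_at_infinity in eventually_elim,
        simp add: power_int_diff field_simps)
  with M(1) show ?thesis unfolding pos_growth_def by (intro exI[of _ M]) auto
qed

lemma pos_growth_add:
  assumes "pos_growth f d" "pos_growth g e"
  shows "pos_growth (\<lambda>t. f t + g t) (max d e)"
proof (cases d e rule: linorder_cases)
  case less
  then show ?thesis using pos_growth_add_less[OF assms less] by (simp add: max_def)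
next
  case greater
  then show ?thesis
    using pos_growth_add_less[OF assms(2,1) greater] by (simp add: max_def add.commute)
next
  case equal
  obtain L where L: "L > 0" "((\<lambda>t. f t / t powi d) \<longlongrightarrow> complex_of_real L) at_infinity"
    using assms(1) unfolding pos_growth_def by blast
  obtain M where M: "M > 0" "((\<lambda>t. g t / t powi e) \<longlongrightarrow> complex_of_real M) at_infinity"
    using assms(2) unfolding pos_growth_def by blast
  \<comment> \<open>With equal exponents the leading coefficients add up to \<open>L + M\<close>,
    which cannot vanish because both are positive.\<close>
  have "((\<lambda>t. (f t + g t) / t powi d) \<longlongrightarrow> complex_of_real (L + M)) at_infinity"
    using tendsto_add[OF L(2) M(2)] equal by (simp add: add_divide_distrib)
  with L(1) M(1) equal show ?thesis unfolding pos_growth_def by (intro exI[of _ "L + M"]) auto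
qed

section \<open>Rationality of positive functions along a cocharacter\<close>

lemma cofin_rational_divide:
  assumes "cofin_rational f" "cofin_rational g"
  shows "cofin_rational (\<lambda>t. f t / g t)"
proof -
  obtain p q where pq: "p \<noteq> 0" "q \<noteq> 0" "finite {t. f t \<noteq> poly p t / poly q t}"
    using assms(1) unfolding cofin_rational_def by blast
  obtain r s where rs: "r \<noteq> 0" "s \<noteq> 0" "finite {t. g t \<noteq> poly r t / poly s t}"
    using assms(2) unfolding cofin_rational_def by blast
  \<comment> \<open>Since division by 0 gives 0, the rearranged quotient is correct at every point
    outside the two exceptional sets, even at roots of the denominators.\<close>
  have "finite {t. f t / g t \<noteq> poly (p * s) t / poly (q * r) t}"
    by (rule finite_subset[OF _ finite_UnI[OF pq(3) rs(3)]]) auto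
  with pq rs show ?thesis
    unfolding cofin_rational_def by (intro exI[of _ "p * s"] exI[of _ "q * r"]) auto
qed

lemma cofin_rational_finite_zeros:
  assumes "cofin_rational f"
  shows "finite {t. f t = 0}"
proof -
  obtain p q where pq: "p \<noteq> 0" "q \<noteq> 0" "finite {t. f t \<noteq> poly p t / poly q t}"
    using assms(1) unfolding cofin_rational_def by blast
  have "finite ({t. f t \<noteq> poly p t / poly q t} \<union> {t. poly p t = 0} \<union> {t. poly q t = 0})"
    using pq poly_roots_finite by auto
  then show ?thesis by (rule finite_subset[rotated]) auto
qed

lemma cofin_rational_pos_sum:
  assumes "pos_sum J g" "\<xi> \<in> lattice_on J"
  shows "cofin_rational (\<lambda>t. g (cocharacter \<xi> t))"
proof -
  obtain S a where S: "finite S" "S \<noteq> {}" "S \<subseteq> lattice_on J" "\<forall>\<eta>\<in>S. (a \<eta> :: real) > 0"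
    "\<forall>x\<in>torus J. g x = (\<Sum>\<eta>\<in>S. complex_of_real (a \<eta>) * character J \<eta> x)"
    using assms(1) unfolding pos_sum_iff by blast
  \<comment> \<open>Large enough for multiplication by \<open>t ^ N\<close> to clear all negative
    exponents.\<close>
  define N where "N = nat (\<Sum>\<eta>\<in>S. \<bar>pairing J \<eta> \<xi>\<bar>)"
  have N: "pairing J \<eta> \<xi> + int N \<ge> 0" if "\<eta> \<in> S" for \<eta>
    using member_le_sum[of \<eta> S "\<lambda>\<eta>. \<bar>pairing J \<eta> \<xi>\<bar>"] that S(1) by (auto simp: N_def)
  define p where "p = (\<Sum>\<eta>\<in>S. monom (complex_of_real (a \<eta>)) (nat (pairing J \<eta> \<xi> + int N)))"
  have "g (cocharacter \<xi> t) = poly p t / poly (monom 1 N) t" if t: "t \<noteq> 0" for t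
  proof -
    have "g (cocharacter \<xi> t) = (\<Sum>\<eta>\<in>S. of_real (a \<eta>) * t powi pairing J \<eta> \<xi>)"
      using S(5) cocharacter_in_torus[OF assms(2) t] by (simp add: character_cocharacter t)
    also have "\<dots> = (\<Sum>\<eta>\<in>S. of_real (a \<eta>) * t ^ nat (pairing J \<eta> \<xi> + int N) / t ^ N)"
    proof (rule sum.cong[OF refl])
      fix \<eta> assume "\<eta> \<in> S"
      then have "t ^ nat (pairing J \<eta> \<xi> + int N) = t powi (pairing J \<eta> \<xi> + int N)"
        using N by (simp add: power_int_def)
      then show "of_real (a \<eta>) * t powi pairing J \<eta> \<xi> =
          of_real (a \<eta>) * t ^ nat (pairing J \<eta> \<xi> + int N) / t ^ N"
        using t by (simp add: power_int_add)
    qed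
    finally show ?thesis
      by (simp add: p_def poly_sum poly_monom sum_divide_distrib)
  qed
  then have "{t. g (cocharacter \<xi> t) \<noteq> poly p t / poly (monom 1 N) t} \<subseteq> {0}"
    by blast
  then have "finite {t. g (cocharacter \<xi> t) \<noteq> poly p t / poly (monom 1 N) t}"
    by (rule finite_subset) simp
  moreover have "p \<noteq> 0"
  \<comment> \<open>Distinct characters may restrict to the same power of \<open>t\<close>, so
    \<open>p\<close> is tested at 1, where its value is the positive sum of all
    coefficients.\<close>
  proof
    assume "p = 0"
    then have "poly p 1 = 0" by simp
    then have "complex_of_real (\<Sum>\<eta>\<in>S. a \<eta>) = 0"
      by (simp add: p_def poly_sum poly_monom)
    then show False using sum_pos[OF S(1,2), of a] S(4) by (simp flip: of_real_sum)
  qed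
  ultimately show ?thesis
    unfolding cofin_rational_def by (intro exI[of _ p] exI[of _ "monom 1 N"]) auto
qed

text \<open>Where \<open>h\<close> vanishes nothing is known about \<open>f\<close>. Along a
  cocharacter this concerns finitely many \<open>t\<close>, because \<open>h\<close> restricts to a
  nonzero rational function.\<close>

lemma cofin_rational_positive_function:
  assumes "positive_function J f" "\<xi> \<in> lattice_on J"
  shows "cofin_rational (\<lambda>t. f (cocharacter \<xi> t))"
proof -
  obtain g h where gh: "pos_sum J g" "pos_sum J h" "\<forall>x\<in>torus J. h x \<noteq> 0 \<longrightarrow> f x = g x / h x"
    using assms(1) unfolding positive_function_iff by blast
  note g = cofin_rational_pos_sum[OF gh(1) assms(2)]
  note h = cofin_rational_pos_sum[OF gh(2) assms(2)]
  obtain p q where pq: "p \<noteq> 0" "q \<noteq> 0"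
    "finite {t. g (cocharacter \<xi> t) / h (cocharacter \<xi> t) \<noteq> poly p t / poly q t}"
    using cofin_rational_divide[OF g h] unfolding cofin_rational_def by blast
  have "finite {t. f (cocharacter \<xi> t) \<noteq> poly p t / poly q t}"
    by (rule finite_subset[OF _ finite_UnI[OF finite_UnI[OF pq(3)
            cofin_rational_finite_zeros[OF h]] finite.insertI[OF finite.emptyI, of 0]]])
      (use gh(3) cocharacter_in_torus[OF assms(2)] in auto)
  with pq show ?thesis unfolding cofin_rational_def by blast
qed

section \<open>Tropicalization\<close>

text \<open>Positivity provides rationality along cocharacters and growth provides the degree. Both
  are closed under the same operations, so one set of rules handles them together.\<close>

definition tropical ::
    "'i set \<Rightarrow> (('i \<Rightarrow> complex) \<Rightarrow> complex) \<Rightarrow> (('i \<Rightarrow> int) \<Rightarrow> int) \<Rightarrow> bool" where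
  "tropical J f F \<longleftrightarrow> positive_function J f \<and>
     (\<forall>\<xi>\<in>lattice_on J. pos_growth (\<lambda>t. f (cocharacter \<xi> t)) (F \<xi>))"

text \<open>These rules follow the shape of the rational function; repeated application computes its
  tropicalization as a schematic \<open>F\<close>.\<close>

named_theorems trop

lemma tropical_cong:
  assumes "tropical J f F" "\<And>x. x \<in> torus J \<Longrightarrow> f x = g x"
    "\<And>\<xi>. \<xi> \<in> lattice_on J \<Longrightarrow> F \<xi> = G \<xi>"
  shows "tropical J g G"
  unfolding tropical_def
proof (intro conjI ballI)
  show "positive_function J g"
    using assms(1,2) positive_function_cong[of J f g] by (simp add: tropical_def)
  fix \<xi> assume \<xi>: "\<xi> \<in> lattice_on J"
  show "pos_growth (\<lambda>t. g (cocharacter \<xi> t)) (G \<xi>)"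
    by (rule pos_growth_cong[of "\<lambda>t. f (cocharacter \<xi> t)"])
      (use assms cocharacter_in_torus[OF \<xi>] \<xi> in \<open>auto simp: tropical_def\<close>)
qed

lemma tropical_character:
  assumes "\<eta> \<in> lattice_on J"
  shows "tropical J (character J \<eta>) (pairing J \<eta>)"
  unfolding tropical_def
proof (intro conjI ballI)
  show "positive_function J (character J \<eta>)"
    using pos_sum_monomial[OF assms, of 1] by (auto intro: pos_sum_positive_function)
  show "pos_growth (\<lambda>t. character J \<eta> (cocharacter \<xi> t)) (pairing J \<eta> \<xi>)" for \<xi>
    by (rule pos_growth_cong[OF _ pos_growth_powi]) (simp add: character_cocharacter)
qed

lemma tropical_1 [trop]: "tropical J (\<lambda>_. 1) (\<lambda>_. 0)"
  by (rule tropical_cong[OF tropical_character[of "\<lambda>_. 0"]])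
    (auto simp: lattice_on_def character_def pairing_def)

text \<open>
  Coordinates outside \<open>J\<close> are \<open>1\<close> on the torus and \<open>0\<close> on cocharacters, so no case distinction
  is needed.
\<close>

lemma tropical_coord [trop]:
  assumes "finite J"
  shows "tropical J (\<lambda>x. x j) (\<lambda>\<xi>. \<xi> j)"
proof (cases "j \<in> J")
  case True
  have "(\<Prod>i\<in>J. x i powi (if i = j then 1 else 0)) = x j" for x :: "'a \<Rightarrow> complex"
  proof -
    have "(\<Prod>i\<in>J. x i powi (if i = j then 1 else 0)) = (\<Prod>i\<in>J. if i = j then x i else 1)"
      by (rule prod.cong) auto
    also have "\<dots> = x j" using True assms by simp
    finally show ?thesis .
  qed
  moreover have "(\<Sum>i\<in>J. (if i = j then 1 else 0) * \<xi> i) = \<xi> j" for \<xi> :: "'a \<Rightarrow> int"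
  proof -
    have "(\<Sum>i\<in>J. (if i = j then 1 else 0) * \<xi> i) = (\<Sum>i\<in>J. if i = j then \<xi> i else 0)"
      by (rule sum.cong) auto
    also have "\<dots> = \<xi> j" using True assms by simp
    finally show ?thesis .
  qed
  ultimately show ?thesis
    using True
    by (intro tropical_cong[OF tropical_character[of "\<lambda>i. if i = j then 1 else 0"]])
      (auto simp: lattice_on_def character_def pairing_def)
next
  case False
  then show ?thesis
    by (intro tropical_cong[OF tropical_1]) (auto simp: torus_def lattice_on_def)
qed

lemma tropical_mult [trop]:
  assumes "tropical J f F" "tropical J g G"
  shows "tropical J (\<lambda>x. f x * g x) (\<lambda>\<xi>. F \<xi> + G \<xi>)"
  using assms unfolding tropical_def by (auto intro: positive_function_mult pos_growth_mult)

lemma tropical_inverse: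
  assumes "tropical J f F"
  shows "tropical J (\<lambda>x. inverse (f x)) (\<lambda>\<xi>. - F \<xi>)"
  using assms unfolding tropical_def by (auto intro: positive_function_inverse pos_growth_inverse)

lemma tropical_divide [trop]:
  assumes "tropical J f F" "tropical J g G"
  shows "tropical J (\<lambda>x. f x / g x) (\<lambda>\<xi>. F \<xi> - G \<xi>)"
  using tropical_mult[OF assms(1) tropical_inverse[OF assms(2)]] by (simp add: divide_inverse)

lemma tropical_add [trop]:
  assumes "tropical J f F" "tropical J g G"
  shows "tropical J (\<lambda>x. f x + g x) (\<lambda>\<xi>. max (F \<xi>) (G \<xi>))"
  using assms unfolding tropical_def by (auto intro: positive_function_add pos_growth_add)

lemma tropical_power [trop]:
  assumes "tropical J f F"
  shows "tropical J (\<lambda>x. f x ^ k) (\<lambda>\<xi>. int k * F \<xi>)"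
proof (induction k)
  case (Suc k)
  show ?case using tropical_mult[OF assms Suc] by (simp add: algebra_simps)
qed (simp add: tropical_1)

lemma tropical_powi:
  assumes "tropical J f F"
  shows "tropical J (\<lambda>x. f x powi k) (\<lambda>\<xi>. k * F \<xi>)"
  using tropical_power[OF assms, of "nat k"]
    tropical_power[OF tropical_inverse[OF assms], of "nat (- k)"]
  by (cases "k \<ge> 0") (simp_all add: power_int_def)

lemma tropical_prod:
  assumes "finite A" "\<And>i. i \<in> A \<Longrightarrow> tropical J (f i) (F i)"
  shows "tropical J (\<lambda>x. \<Prod>i\<in>A. f i x) (\<lambda>\<xi>. \<Sum>i\<in>A. F i \<xi>)"
  using assms by (induction A rule: finite_induct) (auto intro: tropical_1 tropical_mult)

lemma tropical_sum [trop]: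
  assumes "finite A" "A \<noteq> {}" "\<And>i. i \<in> A \<Longrightarrow> tropical J (f i) (F i)"
  shows "tropical J (\<lambda>x. \<Sum>i\<in>A. f i x) (\<lambda>\<xi>. MAX i\<in>A. F i \<xi>)"
  using assms by (induction A rule: finite_ne_induct) (auto intro: tropical_add)

text \<open>A character of the target composed with \<open>f\<close> is a product of integer powers
  of coordinates of \<open>f\<close>, so the tropicalized coordinates give all degrees in the
  definition of \<open>UD\<close>. Conversely, the unit characters recover each coordinate, which
  makes the cocharacter unique.\<close>

lemma UD_eq:
  assumes "finite J'" "\<And>k. k \<in> J' \<Longrightarrow> tropical J (\<lambda>x. f x k) (F k)" "\<xi> \<in> lattice_on J"
  shows "UD J J' f \<xi> = (\<lambda>k. if k \<in> J' then F k \<xi> else 0)"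
proof -
  have *: "tropical J (character J' \<eta> \<circ> f) (\<lambda>\<xi>. \<Sum>k\<in>J'. \<eta> k * F k \<xi>)" for \<eta>
    unfolding character_def comp_def using assms(1,2) by (intro tropical_prod tropical_powi) auto
  have deg: "rat_degree (character J' \<eta> \<circ> f \<circ> cocharacter \<xi>) = (\<Sum>k\<in>J'. \<eta> k * F k \<xi>)" for \<eta>
    using *[of \<eta>] assms(3) cofin_rational_positive_function[of J "character J' \<eta> \<circ> f" \<xi>]
    by (auto simp: tropical_def comp_def intro!: rat_degree_eq)
  have "(THE \<zeta>. \<zeta> \<in> lattice_on J' \<and> (\<forall>\<eta>\<in>lattice_on J'.
            pairing J' \<eta> \<zeta> = rat_degree (character J' \<eta> \<circ> f \<circ> cocharacter \<xi>))) =
          (\<lambda>k. if k \<in> J' then F k \<xi> else 0)"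
  proof (rule the_equality)
    show "(\<lambda>k. if k \<in> J' then F k \<xi> else 0) \<in> lattice_on J' \<and> (\<forall>\<eta>\<in>lattice_on J'.
            pairing J' \<eta> (\<lambda>k. if k \<in> J' then F k \<xi> else 0) =
            rat_degree (character J' \<eta> \<circ> f \<circ> cocharacter \<xi>))"
      by (auto simp: deg pairing_def lattice_on_def intro!: sum.cong)
  next
    fix \<zeta>
    assume \<zeta>: "\<zeta> \<in> lattice_on J' \<and> (\<forall>\<eta>\<in>lattice_on J'.
            pairing J' \<eta> \<zeta> = rat_degree (character J' \<eta> \<circ> f \<circ> cocharacter \<xi>))"
    show "\<zeta> = (\<lambda>k. if k \<in> J' then F k \<xi> else 0)"
    proof
      fix k
      show "\<zeta> k = (if k \<in> J' then F k \<xi> else 0)"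
      proof (cases "k \<in> J'")
        case True
        have unit: "(\<Sum>i\<in>J'. (if i = k then 1 else 0) * g i) = g k" for g :: "_ \<Rightarrow> int"
        proof -
          have "(\<Sum>i\<in>J'. (if i = k then 1 else 0) * g i) = (\<Sum>i\<in>J'. if i = k then g i else 0)"
            by (rule sum.cong) auto
          also have "\<dots> = g k" using True assms(1) by simp
          finally show ?thesis .
        qed
        have "(\<lambda>i. if i = k then 1 else 0) \<in> lattice_on J'"
          using True by (auto simp: lattice_on_def)
        with \<zeta> have "pairing J' (\<lambda>i. if i = k then 1 else 0) \<zeta> =
            (\<Sum>i\<in>J'. (if i = k then 1 else 0) * F i \<xi>)"
          by (metis deg)
        then show ?thesis using True by (simp add: pairing_def unit)
      qed (use \<zeta> in \<open>auto simp: lattice_on_def\<close>)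
    qed
  qed
  moreover have "positive_morphism J J' f"
    using * by (simp add: positive_morphism_def tropical_def)
  ultimately show ?thesis by (simp add: UD_def)
qed

lemma UD_fun_eq:
  assumes "tropical J f F" "\<xi> \<in> lattice_on J"
  shows "UD_fun J f \<xi> = F \<xi>"
  using UD_eq[of "{()}" J "\<lambda>x _. f x" "\<lambda>_. F" \<xi>] assms by (simp add: UD_fun_def)

section \<open>The ultra-discretized crystal\<close>

lemma finite_coords [trop]: "finite (coords n)"
  by (simp add: coords_def)

lemma finite_insert_coords [trop]: "finite (insert k (coords n))"
  by (simp add: coords_def)

lemma in_coords_iff: "k \<in> coords n \<longleftrightarrow> 2 \<le> k \<and> k < 2 * n"
  by (auto simp: coords_def)

section \<open>Tropical weights and epsilon functions\<close>

lemma UD_gamma: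
  assumes "\<xi> \<in> lattice_on (coords n)"
  shows "UD_fun (coords n) (geom_gamma n i) \<xi> =
     (if i = 0 then - \<xi> n - \<xi> (n + 1)
      else if i = 1 then 2 * \<xi> (n + 1) - \<xi> 2 - \<xi> (n + 2)
      else if i = n then 2 * \<xi> n - \<xi> (n - 1) - \<xi> (2 * n - 1)
      else 2 * \<xi> i + 2 * \<xi> (n + i) -
        (\<xi> (i - 1) + \<xi> (i + 1) + \<xi> (n + i - 1) + \<xi> (n + i + 1)))"
proof -
  \<comment> \<open>\<open>geom_gamma\<close> tests 0 and 1 before \<open>n\<close>, hence the side
    conditions of the third case.\<close>
  consider "i = 0" | "i = 1" | "i = n" "n \<noteq> 0" "n \<noteq> 1" | "i \<noteq> 0" "i \<noteq> 1" "i \<noteq> n" by blast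
  then have "tropical (coords n) (geom_gamma n i) (\<lambda>\<xi>.
      if i = 0 then - \<xi> n - \<xi> (n + 1)
      else if i = 1 then 2 * \<xi> (n + 1) - \<xi> 2 - \<xi> (n + 2)
      else if i = n then 2 * \<xi> n - \<xi> (n - 1) - \<xi> (2 * n - 1)
      else 2 * \<xi> i + 2 * \<xi> (n + i) -
        (\<xi> (i - 1) + \<xi> (i + 1) + \<xi> (n + i - 1) + \<xi> (n + i + 1)))"
  proof cases
    case 1
    show ?thesis
      by (rule tropical_cong[where f = "\<lambda>x. 1 / (x n * x (n + 1))"], (rule trop)+)
        (use 1 in \<open>simp_all add: geom_gamma_def\<close>)
  next
    case 2
    show ?thesis
      by (rule tropical_cong[where f = "\<lambda>x. x (n + 1) ^ 2 / (x 2 * x (n + 2))"], (rule trop)+)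
        (use 2 in \<open>simp_all add: geom_gamma_def\<close>)
  next
    case 3
    show ?thesis
      by (rule tropical_cong[where f = "\<lambda>x. x n ^ 2 / (x (n - 1) * x (2 * n - 1))"],
          (rule trop)+)
        (use 3 in \<open>simp_all add: geom_gamma_def\<close>)
  next
    case 4
    show ?thesis
      by (rule tropical_cong[where f = "\<lambda>x. x i ^ 2 * x (n + i) ^ 2 /
           (x (i - 1) * x (i + 1) * x (n + i - 1) * x (n + i + 1))"], (rule trop)+)
        (use 4 in \<open>simp_all add: geom_gamma_def\<close>)
  qed
  from UD_fun_eq[OF this assms] show ?thesis .
qed

text \<open>The tropical counterpart of the ratio \<open>x k / x (n + k - 1)\<close> in
  \<open>geom_eps\<close>, \<open>X_low\<close> and \<open>X_high\<close>.\<close>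

definition beta :: "nat \<Rightarrow> (nat \<Rightarrow> int) \<Rightarrow> nat \<Rightarrow> int" where
  "beta n x k = x k - x (n + k - 1)"

lemma UD_eps:
  assumes "n \<ge> 2" "\<xi> \<in> lattice_on (coords n)"
  shows "UD_fun (coords n) (geom_eps n i) \<xi> =
     (if i = 0 then \<xi> (n + 1) + (MAX j\<in>{2..n}. beta n \<xi> j)
      else if i = 1 then \<xi> (n + 2) - \<xi> (n + 1)
      else if i = n then \<xi> (2 * n - 1) - \<xi> n
      else max (\<xi> (n + i + 1) - \<xi> (n + i))
        (\<xi> (i + 1) + \<xi> (n + i - 1) + \<xi> (n + i + 1) - (\<xi> i + 2 * \<xi> (n + i))))"
proof -
  consider "i = 0" | "i = 1" | "i = n" "n \<noteq> 0" "n \<noteq> 1" | "i \<noteq> 0" "i \<noteq> 1" "i \<noteq> n" by blast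
  then have "tropical (coords n) (geom_eps n i) (\<lambda>\<xi>.
      if i = 0 then \<xi> (n + 1) + (MAX j\<in>{2..n}. beta n \<xi> j)
      else if i = 1 then \<xi> (n + 2) - \<xi> (n + 1)
      else if i = n then \<xi> (2 * n - 1) - \<xi> n
      else max (\<xi> (n + i + 1) - \<xi> (n + i))
        (\<xi> (i + 1) + \<xi> (n + i - 1) + \<xi> (n + i + 1) - (\<xi> i + 2 * \<xi> (n + i))))"
  proof cases
    case 1
    \<comment> \<open>Required by \<open>tropical_sum\<close>: an empty sum is 0 and has no growth
      exponent.\<close>
    have nonempty: "{2..n} \<noteq> {}" using assms(1) by simp
    show ?thesis
      by (rule tropical_cong[where f = "\<lambda>x. x (n + 1) * (\<Sum>j=2..n. x j / x (n + j - 1))"],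
          (rule trop finite_atLeastAtMost nonempty)+)
        (use 1 in \<open>simp_all add: geom_eps_def beta_def\<close>)
  next
    case 2
    show ?thesis
      by (rule tropical_cong[where f = "\<lambda>x. x (n + 2) / x (n + 1)"], (rule trop)+)
        (use 2 in \<open>simp_all add: geom_eps_def\<close>)
  next
    case 3
    show ?thesis
      by (rule tropical_cong[where f = "\<lambda>x. x (2 * n - 1) / x n"], (rule trop)+)
        (use 3 in \<open>simp_all add: geom_eps_def\<close>)
  next
    case 4
    show ?thesis
      by (rule tropical_cong[where f = "\<lambda>x. x (n + i + 1) / x (n + i) +
           x (i + 1) * x (n + i - 1) * x (n + i + 1) / (x i * x (n + i) ^ 2)"], (rule trop)+)
        (use 4 in \<open>simp_all add: geom_eps_def\<close>)
  qed
  from UD_fun_eq[OF this assms(2)] show ?thesis .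
qed

section \<open>Tropical actions of the operators\<close>

text \<open>\<open>F k\<close> still depends on the parameter, which is coordinate 0 of the enlarged
  torus; the integer \<open>c\<close> enters only by evaluation at
  \<open>\<xi>(0 := c)\<close>.\<close>

lemma UD_e_eqI:
  assumes "\<xi> \<in> lattice_on (coords n)" "\<zeta> \<in> lattice_on (coords n)"
    and "\<And>k. k \<in> coords n \<Longrightarrow>
      tropical (insert 0 (coords n)) (\<lambda>y. geom_e n i (y 0) (y(0 := 1)) k) (F k)"
    and "\<And>k. k \<in> coords n \<Longrightarrow> F k (\<xi>(0 := c)) = \<zeta> k"
  shows "UD_e n i c \<xi> = \<zeta>"
proof -
  have "\<xi>(0 := c) \<in> lattice_on (insert 0 (coords n))"
    using assms(1) by (auto simp: lattice_on_def)
  from UD_eq[OF finite_coords assms(3) this]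
  have "UD_e n i c \<xi> = (\<lambda>k. if k \<in> coords n then F k (\<xi>(0 := c)) else 0)"
    by (simp add: UD_e_def)
  also have "\<dots> = \<zeta>"
    using assms(2,4) by (auto simp: lattice_on_def)
  finally show ?thesis .
qed

lemma UD_e_1:
  assumes "n \<ge> 2" "\<xi> \<in> lattice_on (coords n)"
  shows "UD_e n 1 c \<xi> = \<xi>(n + 1 := c + \<xi> (n + 1))"
proof (rule UD_e_eqI[OF assms(2), where F = "\<lambda>k \<xi>. if k = n + 1 then \<xi> 0 + \<xi> (n + 1) else \<xi> k"])
  fix k assume "k \<in> coords n"
  \<comment> \<open>Index 0 carries the parameter, so the reset \<open>y(0 := 1)\<close> leaves
    coordinate \<open>k\<close> untouched.\<close>
  then have "k \<noteq> 0" by (simp add: in_coords_iff)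
  show "tropical (insert 0 (coords n)) (\<lambda>y. geom_e n 1 (y 0) (y(0 := 1)) k)
      (\<lambda>\<xi>. if k = n + 1 then \<xi> 0 + \<xi> (n + 1) else \<xi> k)"
  proof (cases "k = n + 1")
    case True
    show ?thesis
      by (rule tropical_cong[where f = "\<lambda>y. y 0 * y (n + 1)"], (rule trop)+)
        (use True in \<open>simp_all add: geom_e_def\<close>)
  next
    case False
    show ?thesis
      by (rule tropical_cong[where f = "\<lambda>y. y k"], (rule trop)+)
        (use False \<open>k \<noteq> 0\<close> in \<open>simp_all add: geom_e_def\<close>)
  qed
qed (use assms in \<open>auto simp: lattice_on_def in_coords_iff\<close>)

lemma UD_e_n:
  assumes "n \<ge> 2" "\<xi> \<in> lattice_on (coords n)"
  shows "UD_e n n c \<xi> = \<xi>(n := c + \<xi> n)"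
proof (rule UD_e_eqI[OF assms(2), where F = "\<lambda>k \<xi>. if k = n then \<xi> 0 + \<xi> n else \<xi> k"])
  fix k assume "k \<in> coords n"
  then have "k \<noteq> 0" by (simp add: in_coords_iff)
  show "tropical (insert 0 (coords n)) (\<lambda>y. geom_e n n (y 0) (y(0 := 1)) k)
      (\<lambda>\<xi>. if k = n then \<xi> 0 + \<xi> n else \<xi> k)"
  proof (cases "k = n")
    case True
    show ?thesis
      by (rule tropical_cong[where f = "\<lambda>y. y 0 * y n"], (rule trop)+)
        (use True assms in \<open>simp_all add: geom_e_def\<close>)
  next
    case False
    show ?thesis
      by (rule tropical_cong[where f = "\<lambda>y. y k"], (rule trop)+)
        (use False assms \<open>k \<noteq> 0\<close> in \<open>simp_all add: geom_e_def\<close>)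
  qed
qed (use assms in \<open>auto simp: lattice_on_def in_coords_iff\<close>)

text \<open>\<open>A\<close> and \<open>B\<close> are the exponents of the two monomials in the
  numerator of \<open>geom_c\<close> apart from the factor \<open>c\<close>, and \<open>C\<close> is
  the tropicalization of \<open>geom_c\<close>.\<close>

lemma UD_e_middle:
  fixes c :: int
  assumes "2 \<le> i" "i < n" "\<xi> \<in> lattice_on (coords n)"
  defines "A \<equiv> \<xi> i + \<xi> (n + i)" and "B \<equiv> \<xi> (i + 1) + \<xi> (n + i - 1)"
  defines "C \<equiv> c + max A B - max (c + A) B"
  shows "UD_e n i c \<xi> = \<xi>(i := C + \<xi> i, n + i := c - C + \<xi> (n + i))"
proof -
  \<comment> \<open>The value \<open>C\<close> as a function of the cocharacter, with the parameter
    read at index 0.\<close>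
  define G where "G = (\<lambda>\<xi> :: nat \<Rightarrow> int. \<xi> 0 + max (\<xi> i + \<xi> (n + i)) (\<xi> (i + 1) + \<xi> (n + i - 1)) -
    max (\<xi> 0 + \<xi> i + \<xi> (n + i)) (\<xi> (i + 1) + \<xi> (n + i - 1)))"
  have G: "tropical (insert 0 (coords n)) (\<lambda>y. geom_c n i (y 0) (y(0 := 1))) G"
    by (rule tropical_cong[where f = "\<lambda>y. y 0 * (y i * y (n + i) + y (i + 1) * y (n + i - 1)) /
          (y 0 * y i * y (n + i) + y (i + 1) * y (n + i - 1))"], (rule trop)+)
      (use assms in \<open>simp_all add: geom_c_def G_def\<close>)
  show ?thesis
  proof (rule UD_e_eqI[OF assms(3), where F = "\<lambda>k \<xi>. if k = i then G \<xi> + \<xi> i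
        else if k = n + i then \<xi> 0 - G \<xi> + \<xi> (n + i) else \<xi> k"])
    fix k assume "k \<in> coords n"
    then have "k \<noteq> 0" by (simp add: in_coords_iff)
    consider "k = i" | "k = n + i" "k \<noteq> i" | "k \<noteq> i" "k \<noteq> n + i" by blast
    then show "tropical (insert 0 (coords n)) (\<lambda>y. geom_e n i (y 0) (y(0 := 1)) k)
        (\<lambda>\<xi>. if k = i then G \<xi> + \<xi> i
          else if k = n + i then \<xi> 0 - G \<xi> + \<xi> (n + i) else \<xi> k)"
    proof cases
      case 1
      show ?thesis
        by (rule tropical_cong[where f = "\<lambda>y. geom_c n i (y 0) (y(0 := 1)) * y i"],
            (rule trop G)+)
          (use 1 assms in \<open>simp_all add: geom_e_def\<close>)
    next
      case 2
      show ?thesis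
        by (rule tropical_cong[where f = "\<lambda>y. y 0 / geom_c n i (y 0) (y(0 := 1)) * y (n + i)"],
            (rule trop G)+)
          (use 2 assms in \<open>simp_all add: geom_e_def\<close>)
    next
      case 3
      show ?thesis
        by (rule tropical_cong[where f = "\<lambda>y. y k"], (rule trop)+)
          (use 3 assms \<open>k \<noteq> 0\<close> in \<open>simp_all add: geom_e_def\<close>)
    qed
  next
    fix k assume "k \<in> coords n"
    then have "k \<noteq> 0" by (simp add: in_coords_iff)
    have "G (\<xi>(0 := c)) = C"
      using assms(1,2) by (simp add: G_def C_def A_def B_def add.assoc)
    then show "(if k = i then G (\<xi>(0 := c)) + (\<xi>(0 := c)) i
        else if k = n + i then (\<xi>(0 := c)) 0 - G (\<xi>(0 := c)) + (\<xi>(0 := c)) (n + i)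
        else (\<xi>(0 := c)) k) = (\<xi>(i := C + \<xi> i, n + i := c - C + \<xi> (n + i))) k"
      using assms(1,2) \<open>k \<noteq> 0\<close> by auto
  qed (use assms(1-3) in \<open>auto simp: lattice_on_def in_coords_iff\<close>)
qed

text \<open>Tropicalization of \<open>X_low\<close>, as \<open>beta_high\<close> is of
  \<open>X_high\<close>; both ranges are nonempty for \<open>2 \<le> k < n\<close>.\<close>

definition beta_low :: "nat \<Rightarrow> (nat \<Rightarrow> int) \<Rightarrow> nat \<Rightarrow> int" where
  "beta_low n x k = (MAX j\<in>{2..k}. beta n x j)"

definition beta_high :: "nat \<Rightarrow> (nat \<Rightarrow> int) \<Rightarrow> nat \<Rightarrow> int" where
  "beta_high n x k = (MAX j\<in>{k+1..n}. beta n x j)"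

text \<open>\<open>C k\<close> is the exponent of the factor multiplying \<open>x k\<close> for
  \<open>k < n\<close>. The factor at \<open>n + l\<close> is the inverse of the one at
  \<open>l\<close>, divided by the parameter, hence \<open>- c - C (k - n)\<close>.\<close>

lemma UD_e_0:
  fixes c :: int
  assumes "n \<ge> 2" "\<xi> \<in> lattice_on (coords n)"
  defines "C \<equiv> \<lambda>k. max (beta_low n \<xi> k) (beta_high n \<xi> k) -
                      max (c + beta_low n \<xi> k) (beta_high n \<xi> k)"
  shows "UD_e n 0 c \<xi> = (\<lambda>k.
     if 2 \<le> k \<and> k < n then \<xi> k + C k
     else if k = n \<or> k = n + 1 then \<xi> k - c
     else if n + 2 \<le> k \<and> k < 2 * n then \<xi> k - c - C (k - n)
     else \<xi> k)"
proof -
  have low: "tropical (insert 0 (coords n)) (\<lambda>y. X_low n (y(0 := 1)) k) (\<lambda>\<xi>. beta_low n \<xi> k)"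
    if "2 \<le> k" for k
  proof -
    have nonempty: "{2..k} \<noteq> {}" using that by simp
    show ?thesis
      by (rule tropical_cong[where f = "\<lambda>y. \<Sum>j=2..k. y j / y (n + j - 1)"],
          (rule trop finite_atLeastAtMost nonempty)+)
        (use that in \<open>auto simp: X_low_def beta_low_def beta_def intro!: sum.cong\<close>)
  qed
  have high: "tropical (insert 0 (coords n)) (\<lambda>y. X_high n (y(0 := 1)) k) (\<lambda>\<xi>. beta_high n \<xi> k)"
    if "1 \<le> k" "k < n" for k
  proof -
    have nonempty: "{k + 1..n} \<noteq> {}" using that by simp
    show ?thesis
      by (rule tropical_cong[where f = "\<lambda>y. \<Sum>j=k+1..n. y j / y (n + j - 1)"],
          (rule trop finite_atLeastAtMost nonempty)+)
        (use that in \<open>auto simp: X_high_def beta_high_def beta_def intro!: sum.cong\<close>)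
  qed
  have beta: "beta n (\<xi>(0 := c)) j = beta n \<xi> j" if "j \<ge> 2" for j
    using that by (simp add: beta_def)
  have lowc: "beta_low n (\<xi>(0 := c)) k = beta_low n \<xi> k" for k
    by (simp add: beta_low_def beta cong: image_cong_simp)
  have highc: "beta_high n (\<xi>(0 := c)) k = beta_high n \<xi> k" if "1 \<le> k" for k
    using that by (simp add: beta_high_def beta cong: image_cong_simp)
  define H where "H = (\<lambda>k \<xi>.
     if 2 \<le> k \<and> k < n then
       \<xi> k + (max (beta_low n \<xi> k) (beta_high n \<xi> k) -
         max (\<xi> 0 + beta_low n \<xi> k) (beta_high n \<xi> k))
     else if k = n \<or> k = n + 1 then \<xi> k - \<xi> 0
     else if n + 2 \<le> k \<and> k < 2 * n then
       \<xi> k + (max (\<xi> 0 + beta_low n \<xi> (k - n)) (beta_high n \<xi> (k - n)) -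
         (\<xi> 0 + max (beta_low n \<xi> (k - n)) (beta_high n \<xi> (k - n))))
     else \<xi> k)"
  show ?thesis
  proof (rule UD_e_eqI[OF assms(2), where F = H])
    fix k assume k: "k \<in> coords n"
    then have "k \<noteq> 0" by (simp add: in_coords_iff)
    consider "2 \<le> k" "k < n" | "k = n \<or> k = n + 1" | "n + 2 \<le> k" "k < 2 * n"
      using k by (force simp: in_coords_iff)
    then show "tropical (insert 0 (coords n)) (\<lambda>y. geom_e n 0 (y 0) (y(0 := 1)) k) (H k)"
    proof cases
      case 1
      then have lek: "1 \<le> k" by simp
      show ?thesis
        by (rule tropical_cong[where f = "\<lambda>y. y k *
              ((X_low n (y(0 := 1)) k + X_high n (y(0 := 1)) k) /
               (y 0 * X_low n (y(0 := 1)) k + X_high n (y(0 := 1)) k))"],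
            (rule trop low high 1 lek)+)
          (use 1 in \<open>simp_all add: geom_e_def geom_e0_def H_def\<close>)
    next
      case 2
      show ?thesis
        by (rule tropical_cong[where f = "\<lambda>y. y k / y 0"], (rule trop)+)
          (use 2 \<open>k \<noteq> 0\<close> in \<open>auto simp: geom_e_def geom_e0_def H_def\<close>)
    next
      case 3
      then have lek: "1 \<le> k - n" "2 \<le> k - n" "k - n < n" by auto
      show ?thesis
        by (rule tropical_cong[where f = "\<lambda>y. y k *
              ((y 0 * X_low n (y(0 := 1)) (k - n) + X_high n (y(0 := 1)) (k - n)) /
               (y 0 * (X_low n (y(0 := 1)) (k - n) + X_high n (y(0 := 1)) (k - n))))"],
            (rule trop low high lek)+)
          (use 3 in \<open>simp_all add: geom_e_def geom_e0_def H_def Let_def\<close>)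
    qed
  next
    fix k assume k: "k \<in> coords n"
    then show "H k (\<xi>(0 := c)) = (if 2 \<le> k \<and> k < n then \<xi> k + C k
     else if k = n \<or> k = n + 1 then \<xi> k - c
     else if n + 2 \<le> k \<and> k < 2 * n then \<xi> k - c - C (k - n)
     else \<xi> k)"
      by (cases "n + 2 \<le> k") (simp_all add: H_def C_def in_coords_iff lowc highc)
  qed (use assms(1,2) in \<open>auto simp: lattice_on_def in_coords_iff\<close>)
qed

section \<open>The isomorphism\<close>

text \<open>
  Both rows of \<open>Omega n x\<close> are difference sequences, with partial sums \<open>psum1 n x\<close> and
  \<open>psum2 n x\<close>; this absorbs the special shape of the first and last entries.
\<close>

definition psum1 :: "nat \<Rightarrow> (nat \<Rightarrow> int) \<Rightarrow> nat \<Rightarrow> int" where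
  "psum1 n x i = (if 1 \<le> i \<and> i < n then x (n + i) else 0)"

definition psum2 :: "nat \<Rightarrow> (nat \<Rightarrow> int) \<Rightarrow> nat \<Rightarrow> int" where
  "psum2 n x i = (if 2 \<le> i \<and> i \<le> n then x i else 0)"

lemma Omega_1: "n \<ge> 2 \<Longrightarrow> i \<in> {1..n} \<Longrightarrow> Omega n x 1 i = psum1 n x i - psum1 n x (i - 1)"
  by (auto simp: Omega_def psum1_def mult_2)

lemma Omega_2: "n \<ge> 2 \<Longrightarrow> i \<in> {2..n + 1} \<Longrightarrow> Omega n x 2 i = psum2 n x i - psum2 n x (i - 1)"
  by (cases "i = n + 1") (auto simp: Omega_def psum2_def)

text \<open>The bound \<open>k \<le> Suc m\<close> admits the empty sum, for which both sides are
  0.\<close>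

lemma sum_telescope_pred:
  fixes g :: "nat \<Rightarrow> int"
  assumes "\<And>i. k \<le> i \<Longrightarrow> i \<le> m \<Longrightarrow> f i = g i - g (i - 1)" "1 \<le> k" "k \<le> Suc m"
  shows "(\<Sum>i=k..m. f i) = g m - g (k - 1)"
  using assms
proof (induction m)
  case (Suc m)
  show ?case
  proof (cases "k = Suc (Suc m)")
    case False
    then show ?thesis using Suc by simp
  qed simp
qed (auto simp: le_Suc_eq)

lemma sum_Omega_1:
  assumes "n \<ge> 2" "1 \<le> k" "k \<le> Suc m" "m \<le> n"
  shows "(\<Sum>i=k..m. Omega n x 1 i) = psum1 n x m - psum1 n x (k - 1)"
  using assms by (intro sum_telescope_pred Omega_1) auto

lemma sum_Omega_2:
  assumes "n \<ge> 2" "2 \<le> k" "k \<le> Suc m" "m \<le> Suc n"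
  shows "(\<Sum>i=k..m. Omega n x 2 i) = psum2 n x m - psum2 n x (k - 1)"
  using assms by (intro sum_telescope_pred Omega_2) auto

section \<open>Bijectivity\<close>

lemma Omega_in_B2inf_set:
  assumes "n \<ge> 2"
  shows "Omega n x \<in> B2inf_set n"
proof -
  have "(\<Sum>i=1..n. Omega n x 1 i) = 0"
    using assms by (subst sum_Omega_1) (auto simp: psum1_def)
  moreover have "(\<Sum>i=2..Suc n. Omega n x 2 i) = 0"
    using assms by (subst sum_Omega_2) (auto simp: psum2_def)
  moreover have "{1..2} = {1, 2 :: nat}" by auto
  ultimately have "\<forall>j\<in>{1..2}. (\<Sum>i=j..j + n - 1. Omega n x j i) = 0"
    by simp
  moreover have "Omega n x j i = 0" if "\<not> (j \<in> {1..2} \<and> i \<in> {j..j + n - 1})" for i j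
    using that assms by (auto simp: Omega_def)
  ultimately show ?thesis by (auto simp: B2inf_set_def)
qed

text \<open>Partial sums undo the difference sequences; the value 0 elsewhere puts the result into
  \<open>lattice_on (coords n)\<close>.\<close>

definition Omega_inv :: "nat \<Rightarrow> (nat \<Rightarrow> nat \<Rightarrow> int) \<Rightarrow> nat \<Rightarrow> int" where
  "Omega_inv n b k =
     (if 2 \<le> k \<and> k \<le> n then \<Sum>i=2..k. b 2 i
      else if n + 1 \<le> k \<and> k < 2 * n then \<Sum>i=1..k - n. b 1 i
      else 0)"

lemma Omega_inv_Omega:
  assumes "n \<ge> 2" "x \<in> lattice_on (coords n)"
  shows "Omega_inv n (Omega n x) = x"
proof
  fix k
  consider "2 \<le> k" "k \<le> n" | "n + 1 \<le> k" "k < 2 * n" | "k \<notin> coords n"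
    by (force simp: in_coords_iff)
  then show "Omega_inv n (Omega n x) k = x k"
  proof cases
    case 1
    then have "(\<Sum>i=2..k. Omega n x 2 i) = x k"
      using assms(1) by (subst sum_Omega_2) (auto simp: psum2_def)
    with 1 show ?thesis by (simp add: Omega_inv_def)
  next
    case 2
    then have "(\<Sum>i=1..k - n. Omega n x 1 i) = x k"
      using assms(1) by (subst sum_Omega_1) (auto simp: psum1_def)
    with 2 show ?thesis by (simp add: Omega_inv_def)
  next
    case 3
    then show ?thesis using assms by (auto simp: Omega_inv_def lattice_on_def in_coords_iff)
  qed
qed

lemma Omega_Omega_inv:
  assumes "n \<ge> 2" "b \<in> B2inf_set n"
  shows "Omega n (Omega_inv n b) = b"
proof (intro ext)
  fix j i
  have zero: "b j i = 0" if "\<not> (j \<in> {1..2} \<and> i \<in> {j..j + n - 1})"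
    using assms(2) that by (auto simp: B2inf_set_def)
  have total: "(\<Sum>i=1..n. b 1 i) = 0" "(\<Sum>i=2..n + 1. b 2 i) = 0"
  proof -
    have "\<forall>j\<in>{1..2}. (\<Sum>i=j..j + n - 1. b j i) = 0"
      using assms(2) by (simp add: B2inf_set_def)
    from bspec[OF this, of 1] bspec[OF this, of 2]
    show "(\<Sum>i=1..n. b 1 i) = 0" "(\<Sum>i=2..n + 1. b 2 i) = 0" by simp_all
  qed
  \<comment> \<open>At \<open>k = n\<close> the vanishing row sum in \<open>B2inf_set\<close>
    matches the cut-off value of \<open>psum1\<close>.\<close>
  have sum1: "(\<Sum>i=1..k. b 1 i) = (if k = n then 0 else psum1 n (Omega_inv n b) k)" if "k \<le> n" for k
    using total that by (auto simp: psum1_def Omega_inv_def)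
  have sum2: "(\<Sum>i=2..k. b 2 i) = (if k = n + 1 then 0 else psum2 n (Omega_inv n b) k)" if "k \<le> n + 1" for k
    using total that by (auto simp: psum2_def Omega_inv_def)
  consider "j = 1" "i \<in> {1..n}" | "j = 2" "i \<in> {2..n + 1}" | "\<not> (j \<in> {1..2} \<and> i \<in> {j..j + n - 1})"
    by force
  then show "Omega n (Omega_inv n b) j i = b j i"
  proof cases
    case 1
    have "(\<Sum>i=1..i. b 1 i) = (\<Sum>i=1..i - 1. b 1 i) + b 1 i"
      using 1 by (cases i) auto
    with 1 assms(1) sum1[of i] sum1[of "i - 1"] show ?thesis
      by (auto simp: Omega_1[unfolded One_nat_def] psum1_def split: if_splits)
  next
    case 2
    have "(\<Sum>i=2..i. b 2 i) = (\<Sum>i=2..i - 1. b 2 i) + b 2 i"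
      using 2 by (cases i) auto
    with 2 assms(1) sum2[of i] sum2[of "i - 1"] show ?thesis
      by (auto simp: Omega_2 psum2_def split: if_splits)
  next
    case 3
    have "Omega n (Omega_inv n b) j i = 0"
      using Omega_in_B2inf_set[OF assms(1)] 3 by (auto simp: B2inf_set_def)
    with zero[OF 3] show ?thesis by simp
  qed
qed

lemma bij_betw_Omega:
  assumes "n \<ge> 2"
  shows "bij_betw (Omega n) (lattice_on (coords n)) (B2inf_set n)"
proof (rule bij_betw_byWitness[where f' = "Omega_inv n"])
  show "Omega_inv n ` B2inf_set n \<subseteq> lattice_on (coords n)"
    by (auto simp: Omega_inv_def lattice_on_def in_coords_iff)
qed (use assms in \<open>auto simp: Omega_inv_Omega Omega_Omega_inv Omega_in_B2inf_set\<close>)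

section \<open>The conditions on \<open>m\<close> as first and last maximum of
  \<open>beta\<close>\<close>

lemma sum_zdiff_Omega:
  assumes "2 \<le> k" "k \<le> m" "m \<le> n"
  shows "(\<Sum>i=k..m - 1. zdiff (Omega n x) i) = beta n x k - beta n x m"
proof -
  have "{k..m - 1} = {k..<m}" using assms by auto
  then have "(\<Sum>i=k..m - 1. zdiff (Omega n x) i) = (\<Sum>i=k..<m. - beta n x (Suc i) - (- beta n x i))"
    using assms by (intro sum.cong) (auto simp: zdiff_def Omega_def beta_def)
  also have "\<dots> = beta n x k - beta n x m"
    using sum_Suc_diff'[OF assms(2), of "\<lambda>i. - beta n x i"] by simp
  finally show ?thesis .
qed

definition first_argmax :: "nat \<Rightarrow> (nat \<Rightarrow> int) \<Rightarrow> nat \<Rightarrow> bool" where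
  "first_argmax n g m \<longleftrightarrow> m \<in> {2..n} \<and>
     (\<forall>j\<in>{2..<m}. g j < g m) \<and> (\<forall>j\<in>{m<..n}. g j \<le> g m)"

definition last_argmax :: "nat \<Rightarrow> (nat \<Rightarrow> int) \<Rightarrow> nat \<Rightarrow> bool" where
  "last_argmax n g m \<longleftrightarrow> m \<in> {2..n} \<and>
     (\<forall>j\<in>{2..<m}. g j \<le> g m) \<and> (\<forall>j\<in>{m<..n}. g j < g m)"

text \<open>The predicate \<open>P\<close> is arbitrary because \<open>condE\<close> and
  \<open>condF\<close> differ only in which inequalities are strict.\<close>

lemma all_sum_zdiff:
  assumes "m \<in> {2..n}"
  shows "(\<forall>k\<in>{2..m - 1}. P (\<Sum>i=k..m - 1. zdiff (Omega n x) i)) \<longleftrightarrow>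
           (\<forall>j\<in>{2..<m}. P (beta n x j - beta n x m))"
    and "(\<forall>k\<in>{m..n - 1}. P (\<Sum>i=m..k. zdiff (Omega n x) i)) \<longleftrightarrow>
           (\<forall>j\<in>{m<..n}. P (beta n x m - beta n x j))"
proof -
  have "{2..m - 1} = {2..<m}" using assms by auto
  then show "(\<forall>k\<in>{2..m - 1}. P (\<Sum>i=k..m - 1. zdiff (Omega n x) i)) \<longleftrightarrow>
           (\<forall>j\<in>{2..<m}. P (beta n x j - beta n x m))"
    using assms by (intro ball_cong) (auto simp: sum_zdiff_Omega[unfolded One_nat_def])
  \<comment> \<open>A sum ending at \<open>k\<close> reaches \<open>beta\<close> at
    \<open>k + 1\<close>, which shifts the range to \<open>{m<..n}\<close>.\<close>
  have "(\<Sum>i=m..k. zdiff (Omega n x) i) = beta n x m - beta n x (Suc k)" if "k \<in> {m..n - 1}" for k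
    using sum_zdiff_Omega[of m "Suc k" n x] that assms by auto
  then have "(\<forall>k\<in>{m..n - 1}. P (\<Sum>i=m..k. zdiff (Omega n x) i)) \<longleftrightarrow>
      (\<forall>j\<in>Suc ` {m..n - 1}. P (beta n x m - beta n x j))"
    by (simp only: ball_simps cong: ball_cong)
  also have "Suc ` {m..n - 1} = {m<..n}"
    using assms by (auto simp: image_Suc_atLeastAtMost)
  finally show "(\<forall>k\<in>{m..n - 1}. P (\<Sum>i=m..k. zdiff (Omega n x) i)) \<longleftrightarrow>
           (\<forall>j\<in>{m<..n}. P (beta n x m - beta n x j))" .
qed

text \<open>Keeping \<open>m \<in> {2..n}\<close> on the left lets this rewrite the whole predicate
  under \<open>THE\<close> in \<open>B_e\<close>.\<close>

lemma condE_Omega: "m \<in> {2..n} \<and> condE n (Omega n x) m \<longleftrightarrow> first_argmax n (beta n x) m"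
proof (cases "m \<in> {2..n}")
  case True
  from all_sum_zdiff(1)[OF this, of "\<lambda>s. s < 0" x] all_sum_zdiff(2)[OF this, of "\<lambda>s. s \<ge> 0" x] True
  show ?thesis
    unfolding condE_def first_argmax_def by simp
qed (auto simp: first_argmax_def)

lemma condF_Omega: "m \<in> {2..n} \<and> condF n (Omega n x) m \<longleftrightarrow> last_argmax n (beta n x) m"
proof (cases "m \<in> {2..n}")
  case True
  from all_sum_zdiff(1)[OF this, of "\<lambda>s. s \<le> 0" x] all_sum_zdiff(2)[OF this, of "\<lambda>s. s > 0" x] True
  show ?thesis
    unfolding condF_def last_argmax_def by simp
qed (auto simp: last_argmax_def)

text \<open>The least maximizer exists. If \<open>m < m'\<close> both qualified, the strict
  condition at \<open>m'\<close> would contradict the weak one at \<open>m\<close>.\<close>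

lemma ex1_first_argmax:
  assumes "n \<ge> 2"
  shows "\<exists>!m. first_argmax n g m"
proof (rule ex_ex1I)
  define S where "S = {m\<in>{2..n}. g m = Max (g ` {2..n})}"
  have "Max (g ` {2..n}) \<in> g ` {2..n}" using assms by (intro Max_in) auto
  then have S: "finite S" "S \<noteq> {}" by (auto simp: S_def)
  then have "Min S \<in> S" "\<forall>m\<in>S. Min S \<le> m" by auto
  then obtain p where p: "p \<in> S" "\<And>m. m \<in> S \<Longrightarrow> p \<le> m" by blast
  have le: "g j \<le> g p" if "j \<in> {2..n}" for j
    using p(1) that by (simp add: S_def)
  have "g j < g p" if "j \<in> {2..<p}" for j
  proof -
    have "j \<in> {2..n}" using that p(1) by (auto simp: S_def)
    moreover have "j \<notin> S" using that p(2)[of j] by auto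
    ultimately show ?thesis using le[of j] p(1) by (auto simp: S_def less_le)
  qed
  then show "\<exists>m. first_argmax n g m"
    using p(1) le by (intro exI[of _ p]) (auto simp: first_argmax_def S_def)
  have "\<not> m < m'" if "first_argmax n g m" "first_argmax n g m'" for m m'
  proof
    assume "m < m'"
    with that have "g m < g m'" "g m' \<le> g m"
      by (simp_all add: first_argmax_def)
    then show False by simp
  qed
  then show "m = m'" if "first_argmax n g m" "first_argmax n g m'" for m m'
    using that by (metis linorder_neqE_nat)
qed

text \<open>The mirror image, with the greatest maximizer; now the strict condition comes from the
  smaller index.\<close>

lemma ex1_last_argmax:
  assumes "n \<ge> 2"
  shows "\<exists>!m. last_argmax n g m"
proof (rule ex_ex1I)
  define S where "S = {m\<in>{2..n}. g m = Max (g ` {2..n})}"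
  have "Max (g ` {2..n}) \<in> g ` {2..n}" using assms by (intro Max_in) auto
  then have S: "finite S" "S \<noteq> {}" by (auto simp: S_def)
  then have "Max S \<in> S" "\<forall>m\<in>S. m \<le> Max S" by auto
  then obtain p where p: "p \<in> S" "\<And>m. m \<in> S \<Longrightarrow> m \<le> p" by blast
  have le: "g j \<le> g p" if "j \<in> {2..n}" for j
    using p(1) that by (simp add: S_def)
  have "g j < g p" if "j \<in> {p<..n}" for j
  proof -
    have "j \<in> {2..n}" using that p(1) by (auto simp: S_def)
    moreover have "j \<notin> S" using that p(2)[of j] by auto
    ultimately show ?thesis using le[of j] p(1) by (auto simp: S_def less_le)
  qed
  then show "\<exists>m. last_argmax n g m"
    using p(1) le by (intro exI[of _ p]) (auto simp: last_argmax_def S_def)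
  have "\<not> m < m'" if "last_argmax n g m" "last_argmax n g m'" for m m'
  proof
    assume "m < m'"
    with that have "g m \<le> g m'" "g m' < g m"
      by (simp_all add: last_argmax_def)
    then show False by simp
  qed
  then show "m = m'" if "last_argmax n g m" "last_argmax n g m'" for m m'
    using that by (metis linorder_neqE_nat)
qed

section \<open>The operators for \<open>i = 0\<close>\<close>

text \<open>The maximum at \<open>m\<close> lies in the low part if \<open>m \<le> k\<close> and in
  the high part otherwise. The tie-breaking is what each sign needs: between integers a shift by one
  cannot reverse a strict inequality, so the same part still attains the maximum after the shift,
  and \<open>C k\<close> is \<open>- d\<close> or 0 accordingly.\<close>

lemma UD_e_0_unit:
  assumes "n \<ge> 2" "x \<in> lattice_on (coords n)"
    and "d = 1 \<and> first_argmax n (beta n x) m \<or> d = - 1 \<and> last_argmax n (beta n x) m"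
  shows "UD_e n 0 d x = (\<lambda>k.
     if 2 \<le> k \<and> k \<le> n then x k - (if m \<le> k then d else 0)
     else if n + 1 \<le> k \<and> k < 2 * n then x k - (if k - n < m then d else 0)
     else x k)"
proof -
  have m: "m \<in> {2..n}"
    using assms(3) by (auto simp: first_argmax_def last_argmax_def)
  define C where "C = (\<lambda>k. max (beta_low n x k) (beta_high n x k) -
                      max (d + beta_low n x k) (beta_high n x k))"
  have C: "C k = (if m \<le> k then - d else 0)" if k: "2 \<le> k" "k < n" for k
  proof (cases "m \<le> k")
    case True
    have "beta_low n x k = beta n x m"
      unfolding beta_low_def
    proof (rule Max_eqI)
      fix y assume "y \<in> beta n x ` {2..k}"
      then obtain j where j: "j \<in> {2..k}" "y = beta n x j" by auto
      consider "j < m" | "j = m" | "m < j" by linarith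
      then show "y \<le> beta n x m"
        using assms(3) j k by cases (auto simp: first_argmax_def last_argmax_def intro: less_imp_le)
    qed (use True m in auto)
    moreover have "beta_high n x k \<le> beta n x m" if "d = 1"
      using assms(3) that True k by (auto simp: beta_high_def first_argmax_def)
    moreover have "beta_high n x k < beta n x m" if "d = - 1"
      using assms(3) that True k by (auto simp: beta_high_def last_argmax_def)
    ultimately show ?thesis
      using assms(3) True by (auto simp: C_def)
  next
    case False
    have "beta_high n x k = beta n x m"
      unfolding beta_high_def
    proof (rule Max_eqI)
      fix y assume "y \<in> beta n x ` {k + 1..n}"
      then obtain j where j: "j \<in> {k + 1..n}" "y = beta n x j" by auto
      consider "j < m" | "j = m" | "m < j" by linarith
      then show "y \<le> beta n x m"
        using assms(3) j k by cases (auto simp: first_argmax_def last_argmax_def intro: less_imp_le)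
    qed (use False m in auto)
    moreover have "beta_low n x k < beta n x m" if "d = 1"
      using assms(3) that False k by (auto simp: beta_low_def first_argmax_def)
    moreover have "beta_low n x k \<le> beta n x m" if "d = - 1"
      using assms(3) that False k by (auto simp: beta_low_def last_argmax_def)
    ultimately show ?thesis
      using assms(3) False by (auto simp: C_def)
  qed
  have "UD_e n 0 d x = (\<lambda>k.
     if 2 \<le> k \<and> k < n then x k + C k
     else if k = n \<or> k = n + 1 then x k - d
     else if n + 2 \<le> k \<and> k < 2 * n then x k - d - C (k - n)
     else x k)"
    unfolding C_def by (rule UD_e_0[OF assms(1,2)])
  also have "\<dots> = (\<lambda>k.
     if 2 \<le> k \<and> k \<le> n then x k - (if m \<le> k then d else 0)
     else if n + 1 \<le> k \<and> k < 2 * n then x k - (if k - n < m then d else 0)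
     else x k)"
    \<comment> \<open>The unconditional change at \<open>k = n\<close> and \<open>k = n + 1\<close>
      fits the pattern because \<open>2 \<le> m \<le> n\<close>.\<close>
    using m by (auto simp: fun_eq_iff C)
  finally show ?thesis .
qed

text \<open>The partial sums drop by \<open>d\<close> on the segment from 1 to \<open>m - 1\<close>
  in the first row and from \<open>m\<close> to \<open>n\<close> in the second. Differences change
  only at the ends of these segments: at 1 and \<open>m\<close>, respectively at \<open>m\<close>
  and \<open>n + 1\<close>.\<close>

lemma Omega_UD_e_0:
  assumes "n \<ge> 2" "x \<in> lattice_on (coords n)"
    and "d = 1 \<and> first_argmax n (beta n x) m \<or> d = - 1 \<and> last_argmax n (beta n x) m"
  shows "Omega n (UD_e n 0 d x) =
    (add_entry 1 1 (- d) \<circ> add_entry 1 m d \<circ> add_entry 2 m (- d) \<circ> add_entry 2 (n + 1) d)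
      (Omega n x)" (is "Omega n ?y = ?b")
proof -
  have m: "2 \<le> m" "m \<le> n"
    using assms(3) by (auto simp: first_argmax_def last_argmax_def)
  have psum1: "psum1 n ?y i = psum1 n x i - (if 1 \<le> i \<and> i < m then d else 0)" for i
    using m by (auto simp: psum1_def UD_e_0_unit[OF assms])
  have psum2: "psum2 n ?y i = psum2 n x i - (if m \<le> i \<and> i \<le> n then d else 0)" for i
    using m by (auto simp: psum2_def UD_e_0_unit[OF assms])
  show ?thesis
  proof (intro ext)
    fix j i :: nat
    consider "j = 1" "i \<in> {1..n}" | "j = 2" "i \<in> {2..n + 1}"
      | "\<not> (j \<in> {1..2} \<and> i \<in> {j..j + n - 1})"
      by force
    then show "Omega n ?y j i = ?b j i"
    proof cases
      case 1
      then have "Omega n ?y 1 i = Omega n x 1 i - (if i = 1 then d else 0) + (if i = m then d else 0)"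
        unfolding Omega_1[OF assms(1) 1(2)] psum1 using m by auto
      with 1 m show ?thesis by (auto simp: add_entry_def)
    next
      case 2
      then have "Omega n ?y 2 i = Omega n x 2 i - (if i = m then d else 0) + (if i = n + 1 then d else 0)"
        unfolding Omega_2[OF assms(1) 2(2)] psum2 using m by auto
      with 2 m show ?thesis by (auto simp: add_entry_def)
    next
      case 3
      then have "?b j i = Omega n x j i"
        using m by (auto simp: add_entry_def)
      moreover have "Omega n z j i = 0" for z
        using Omega_in_B2inf_set[OF assms(1), of z] 3 by (auto simp: B2inf_set_def)
      ultimately show ?thesis by simp
    qed
  qed
qed

lemma B_e_Omega_0:
  assumes "n \<ge> 2" "x \<in> lattice_on (coords n)"
  shows "Omega n (UD_e n 0 1 x) = B_e n 0 (Omega n x)"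
proof -
  have "first_argmax n (beta n x) (THE m. first_argmax n (beta n x) m)"
    using ex1_first_argmax[OF assms(1)] by (rule theI')
  then show ?thesis
    using Omega_UD_e_0[OF assms, of 1] unfolding B_e_def condE_Omega Let_def by simp
qed

lemma B_f_Omega_0:
  assumes "n \<ge> 2" "x \<in> lattice_on (coords n)"
  shows "Omega n (UD_e n 0 (- 1) x) = B_f n 0 (Omega n x)"
proof -
  have "last_argmax n (beta n x) (THE m. last_argmax n (beta n x) m)"
    using ex1_last_argmax[OF assms(1)] by (rule theI')
  then show ?thesis
    using Omega_UD_e_0[OF assms, of "- 1"] unfolding B_f_def condF_Omega Let_def by simp
qed

section \<open>Comparison of epsilon and phi\<close>

text \<open>Each \<open>Delta_at\<close> telescopes to a constant minus \<open>beta n x m\<close>,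
  which turns the minimum into a maximum.\<close>

lemma Delta_Omega:
  assumes "n \<ge> 2"
  shows "Delta n (Omega n x) = x n - x (n + 1) - (MAX j\<in>{2..n}. beta n x j)"
proof -
  have "Delta_at n (Omega n x) m = x n - x (n + 1) - beta n x m" if "m \<in> {2..n}" for m
  proof -
    have "(\<Sum>i=2..m - 1. Omega n x 1 i) = psum1 n x (m - 1) - psum1 n x 1"
      using that sum_Omega_1[of n 2 "m - 1" x] by auto
    moreover have "(\<Sum>i=m + 1..n. Omega n x 2 i) = psum2 n x n - psum2 n x m"
      using that sum_Omega_2[of n "m + 1" n x] by auto
    ultimately show ?thesis
      using that by (auto simp: Delta_at_def psum1_def psum2_def beta_def)
  qed
  then have "Delta_at n (Omega n x) ` {2..n} = (\<lambda>j. x n - x (n + 1) - beta n x j) ` {2..n}"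
    by (intro image_cong) auto
  moreover have "Min ((\<lambda>j. x n - x (n + 1) - beta n x j) ` {2..n}) =
      x n - x (n + 1) - (MAX j\<in>{2..n}. beta n x j)"
  proof (rule Min_eqI)
    have "(MAX j\<in>{2..n}. beta n x j) \<in> beta n x ` {2..n}"
      using assms by (intro Max_in) auto
    then show "x n - x (n + 1) - (MAX j\<in>{2..n}. beta n x j) \<in>
        (\<lambda>j. x n - x (n + 1) - beta n x j) ` {2..n}"
      by auto
  qed auto
  ultimately show ?thesis by (simp add: Delta_def)
qed

text \<open>The conventions \<open>x 1 = 0\<close> and \<open>x (2 * n) = 0\<close> extend the
  generic difference formulas to the boundary entries met at \<open>i = 2\<close> and
  \<open>i + 1 = n\<close>.\<close>

lemma Omega_middle:
  assumes "2 \<le> i" "i < n" "x \<in> lattice_on (coords n)"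
  shows "Omega n x 1 i = x (n + i) - x (n + i - 1)"
    and "Omega n x 1 (i + 1) = x (n + i + 1) - x (n + i)"
    and "Omega n x 2 i = x i - x (i - 1)"
    and "Omega n x 2 (i + 1) = x (i + 1) - x i"
proof -
  have x: "x 1 = 0" "x (2 * n) = 0"
    using assms(3) by (auto simp: lattice_on_def in_coords_iff)
  show "Omega n x 1 (i + 1) = x (n + i + 1) - x (n + i)"
  proof (cases "i + 1 = n")
    case True
    then have "n + i + 1 = 2 * n" "n + i = 2 * n - 1" by auto
    with x(2) have "x (n + i + 1) = 0" "x (n + i) = x (2 * n - 1)" by simp_all
    moreover have "Omega n x 1 n = - x (2 * n - 1)" using assms(1,2) by (auto simp: Omega_def)
    ultimately show ?thesis unfolding True by simp
  qed (use assms in \<open>auto simp: Omega_def\<close>)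
  show "Omega n x 2 i = x i - x (i - 1)"
    using assms x(1) by (cases "i = 2") (auto simp: Omega_def)
qed (use assms in \<open>auto simp: Omega_def\<close>)

lemma B_eps_Omega:
  assumes "n \<ge> 2" "x \<in> lattice_on (coords n)" "i \<le> n"
  shows "B_eps n i (Omega n x) = UD_fun (coords n) (geom_eps n i) x"
proof -
  have x: "x (2 * n) = 0"
    using assms(2) by (auto simp: lattice_on_def in_coords_iff)
  note eps = UD_eps[OF assms(1,2)]
  consider "i = 0" | "i = 1" | "i = n" "n \<noteq> 0" "n \<noteq> 1" | "2 \<le> i" "i < n"
    using assms(1,3) by linarith
  then show ?thesis
  proof cases
    case 1
    have "Omega n x 2 (n + 1) = - x n"
      using assms(1) by (auto simp: Omega_def)
    with 1 assms(1) show ?thesis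
      by (simp add: B_eps_def Delta_Omega eps)
  next
    case 2
    \<comment> \<open>For \<open>n = 2\<close> this is the last entry of its row, and
      \<open>x (n + 2)\<close> is \<open>x (2 * n) = 0\<close>.\<close>
    have "Omega n x 1 2 = x (n + 2) - x (n + 1)"
      using assms(1) x by (cases "n = 2") (auto simp: Omega_def)
    with 2 show ?thesis by (simp add: B_eps_def eps)
  next
    case 3
    have "Omega n x 2 (n + 1) = - x n" "Omega n x 1 n = - x (2 * n - 1)"
      using assms(1) by (auto simp: Omega_def)
    with 3 show ?thesis by (simp add: B_eps_def eps)
  next
    case 4
    \<comment> \<open>The second exponent in \<open>UD_eps\<close> exceeds the first by
      \<open>Omega n x 2 (i + 1) - Omega n x 1 i\<close>, so the maximum is the first plus a
      positive part.\<close>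
    then show ?thesis
      unfolding eps using Omega_middle[OF 4 assms(2)] by (simp add: B_eps_def)
  qed
qed

lemma B_phi_Omega:
  assumes "n \<ge> 2" "x \<in> lattice_on (coords n)" "i \<le> n"
  shows "B_phi n i (Omega n x) =
    UD_fun (coords n) (geom_eps n i) x + UD_fun (coords n) (geom_gamma n i) x"
proof -
  have x: "x 1 = 0"
    using assms(2) by (auto simp: lattice_on_def in_coords_iff)
  note eps = UD_eps[OF assms(1,2)] and gamma = UD_gamma[OF assms(2)]
  consider "i = 0" | "i = 1" | "i = n" "n \<noteq> 0" "n \<noteq> 1" | "2 \<le> i" "i < n"
    using assms(1,3) by linarith
  then show ?thesis
  proof cases
    case 1
    have "Omega n x 1 1 = x (n + 1)"
      by (simp add: Omega_def)
    with 1 assms(1) show ?thesis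
      by (simp add: B_phi_def Delta_Omega eps gamma)
  next
    case 2
    have "Omega n x 1 1 = x (n + 1)" "Omega n x 2 2 = x 2"
      by (simp_all add: Omega_def)
    with 2 show ?thesis by (simp add: B_phi_def eps gamma)
  next
    case 3
    \<comment> \<open>For \<open>n = 2\<close> this is the first entry of its row, and
      \<open>x (n - 1)\<close> is \<open>x 1 = 0\<close>.\<close>
    have "Omega n x 2 n = x n - x (n - 1)"
      using assms(1) x by (cases "n = 2") (auto simp: Omega_def)
    with 3 show ?thesis by (simp add: B_phi_def eps gamma)
  next
    case 4
    then show ?thesis
      unfolding eps gamma using Omega_middle[OF 4 assms(2)] by (simp add: B_phi_def)
  qed
qed

section \<open>The operators for \<open>i \<noteq> 0\<close>\<close>

text \<open>Moving one partial sum by \<open>d\<close> moves the two adjacent differences by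
  \<open>d\<close> and \<open>- d\<close>. The range of \<open>i\<close> includes 1, so this serves
  \<open>UD_e_1\<close> as well as the middle operators.\<close>

lemma Omega_upd_high:
  assumes "1 \<le> i" "i < n"
  shows "Omega n (x(n + i := d + x (n + i))) =
    (add_entry 1 i d \<circ> add_entry 1 (i + 1) (- d)) (Omega n x)"
proof (intro ext)
  fix j k :: nat
  consider "j = 1" "k = i" | "j = 1" "k = i + 1" | "j = 1" "k \<noteq> i" "k \<noteq> i + 1" | "j \<noteq> 1"
    by blast
  then show "Omega n (x(n + i := d + x (n + i))) j k =
    (add_entry 1 i d \<circ> add_entry 1 (i + 1) (- d)) (Omega n x) j k"
    by cases (use assms in \<open>auto simp: Omega_def add_entry_def mult_2\<close>)
qed

text \<open>The same for the second row; here \<open>i = n\<close> is included, for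
  \<open>UD_e_n\<close>.\<close>

lemma Omega_upd_low:
  assumes "2 \<le> i" "i \<le> n"
  shows "Omega n (x(i := d + x i)) =
    (add_entry 2 i d \<circ> add_entry 2 (i + 1) (- d)) (Omega n x)"
proof (intro ext)
  fix j k :: nat
  consider "j = 2" "k = i" | "j = 2" "k = i + 1" | "j = 2" "k \<noteq> i" "k \<noteq> i + 1" | "j \<noteq> 2"
    by blast
  then show "Omega n (x(i := d + x i)) j k =
    (add_entry 2 i d \<circ> add_entry 2 (i + 1) (- d)) (Omega n x) j k"
    by cases (use assms in \<open>cases "i = n"; auto simp: Omega_def add_entry_def\<close>)+
qed

text \<open>\<open>Omega n x 1 i - Omega n x 2 (i + 1)\<close> equals \<open>A - B\<close> in
  \<open>UD_e_middle\<close>. For \<open>c = 1\<close> the value \<open>C\<close> is 0 if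
  \<open>A \<ge> B\<close> and 1 otherwise; for \<open>c = -1\<close> it is 0 if
  \<open>A > B\<close> and -1 otherwise. So exactly one of the two coordinates moves.\<close>

lemma UD_e_middle_unit:
  assumes "2 \<le> i" "i < n" "x \<in> lattice_on (coords n)"
  shows "UD_e n i 1 x =
      (if Omega n x 1 i \<ge> Omega n x 2 (i + 1) then x(n + i := 1 + x (n + i)) else x(i := 1 + x i))"
    and "UD_e n i (- 1) x =
      (if Omega n x 1 i > Omega n x 2 (i + 1) then x(n + i := - 1 + x (n + i)) else x(i := - 1 + x i))"
proof -
  note * = Omega_middle(1,4)[OF assms]
  show "UD_e n i 1 x =
      (if Omega n x 1 i \<ge> Omega n x 2 (i + 1) then x(n + i := 1 + x (n + i)) else x(i := 1 + x i))"
    unfolding UD_e_middle[OF assms] * using assms(1,2) by (auto simp: fun_eq_iff)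
  show "UD_e n i (- 1) x =
      (if Omega n x 1 i > Omega n x 2 (i + 1) then x(n + i := - 1 + x (n + i)) else x(i := - 1 + x i))"
    unfolding UD_e_middle[OF assms] * using assms(1,2) by (auto simp: fun_eq_iff)
qed

lemma B_e_Omega:
  assumes "n \<ge> 2" "x \<in> lattice_on (coords n)" "i \<le> n"
  shows "Omega n (UD_e n i 1 x) = B_e n i (Omega n x)"
proof -
  consider "i = 0" | "i = 1" | "i = n" "n \<noteq> 0" "n \<noteq> 1" | "2 \<le> i" "i < n"
    using assms(1,3) by linarith
  then show ?thesis
  proof cases
    case 1
    then show ?thesis using B_e_Omega_0[OF assms(1,2)] by simp
  next
    case 2
    then show ?thesis
      unfolding 2 UD_e_1[OF assms(1,2)]
      using assms(1) by (subst Omega_upd_high) (auto simp: B_e_def numeral_2_eq_2)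
  next
    case 3
    then show ?thesis
      unfolding 3 UD_e_n[OF assms(1,2)]
      using assms(1) by (subst Omega_upd_low) (auto simp: B_e_def)
  next
    case 4
    then show ?thesis
      unfolding UD_e_middle_unit[OF 4 assms(2)]
      by (auto simp: B_e_def Omega_upd_high Omega_upd_low)
  qed
qed

lemma B_f_Omega:
  assumes "n \<ge> 2" "x \<in> lattice_on (coords n)" "i \<le> n"
  shows "Omega n (UD_e n i (- 1) x) = B_f n i (Omega n x)"
proof -
  consider "i = 0" | "i = 1" | "i = n" "n \<noteq> 0" "n \<noteq> 1" | "2 \<le> i" "i < n"
    using assms(1,3) by linarith
  then show ?thesis
  proof cases
    case 1
    then show ?thesis using B_f_Omega_0[OF assms(1,2)] by simp
  next
    case 2
    then show ?thesis
      unfolding 2 UD_e_1[OF assms(1,2)]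
      using assms(1) by (subst Omega_upd_high) (auto simp: B_f_def numeral_2_eq_2)
  next
    case 3
    then show ?thesis
      unfolding 3 UD_e_n[OF assms(1,2)]
      using assms(1) by (subst Omega_upd_low) (auto simp: B_f_def)
  next
    case 4
    then show ?thesis
      unfolding UD_e_middle_unit[OF 4 assms(2)]
      using 4 Omega_upd_high[of i n x "- 1"] Omega_upd_low[of i n x "- 1"]
      by (auto simp: B_f_def)
  qed
qed

theorem theorem5p1:
  fixes n :: nat
  assumes "n \<ge> 2"
  shows "crystal_iso {0..n} (UD_crystal n) (B2inf n) (Omega n)"
  unfolding crystal_iso_def
proof (intro conjI ballI)
  show "bij_betw (Omega n) (elts (UD_crystal n)) (elts (B2inf n))"
    using bij_betw_Omega[OF assms] by (simp add: UD_crystal_def B2inf_def)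
next
  fix i x
  assume "i \<in> {0..n}" "x \<in> elts (UD_crystal n)"
  then have ix: "i \<le> n" "x \<in> lattice_on (coords n)" by (simp_all add: UD_crystal_def)
  note eqs = B_e_Omega[OF assms ix(2,1)] B_f_Omega[OF assms ix(2,1)]
    B_eps_Omega[OF assms ix(2,1)] B_phi_Omega[OF assms ix(2,1)]
  show "Omega n (etil (UD_crystal n) i x) = etil (B2inf n) i (Omega n x)"
    "Omega n (ftil (UD_crystal n) i x) = ftil (B2inf n) i (Omega n x)"
    "wt (B2inf n) i (Omega n x) = wt (UD_crystal n) i x"
    "eps (B2inf n) i (Omega n x) = eps (UD_crystal n) i x"
    "phi (B2inf n) i (Omega n x) = phi (UD_crystal n) i x"
    by (simp_all add: UD_crystal_def B2inf_def eqs)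
qed

end
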